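(* Let $p\in(1,2]$ and $q>1$ with $p\neq q$, and let $a_{p,q}:J_p\to J_q$ be the quasi-greedy base-change function, where $J_p=[0,\frac1{p-1}]$. (i) The function $a_{p,q}$ is left continuous. It is right continuous at $x\in[0,\frac{1}{p-1})$ if and only if $a_p(x)=b_p(x)$. (ii) If $q<p$, then $a_{p,q}$ is nowhere monotone, it is not left differentiable anywhere (i.e. at any $x\in(0,\frac1{p-1}]$), and it is not right differentiable at $x$ if the greedy expansion $b_p(x)$ contains at most finitely many non-zero digits. (iii) If $q>p$, then $a_{p,q}$ is (strictly) increasing, and hence differentiable almost everywhere.
   Context: For a real base $r>1$ and a sequence $c=(c_i)_{i\ge1}\in\{0,1\}^\infty$ put $\pi_r(c):=\sum_{i=1}^\infty c_i r^{-i}$. The sequence $c$ is an expansion of $x$ in base $r$ if $\pi_r(c)=x$, and $J_r:=\pi_r(\{0,1\}^\infty)$. For $r\in(1,2]$ one has $J_r=[0,\frac1{r-1}]$. Let $p\in(1,2]$ and $x\in J_p$. Greedy expansion $b_p(x)=(b_i)$: if $b_i$ is defined for all $i<n$, then $b_n=1$ if $\left(\sum_{i=1}^{n-1}b_ip^{-i}\right)+p^{-n}\le x$, and $b_n=0$ otherwise. Quasi-greedy expansion $a_p(x)=(a_i)$: $a_p(0):=0^\infty$ (the zero sequence); for $x\in(0,\frac1{p-1}]$, if $a_i$ is defined for all $i<n$, then $a_n=1$ if $\left(\sum_{i=1}^{n-1}a_ip^{-i}\right)+p^{-n}< x$, and $a_n=0$ otherwise. Both are expansions of $x$ in base $p$.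 The quasi-greedy base-change function is $a_{p,q}:=\pi_q\circ a_p:J_p\to J_q$, i.e. $a_{p,q}(x)=\sum_{i\ge1}a_iq^{-i}$ with $(a_i)=a_p(x)$. "Nowhere monotone" means not monotone on any non-degenerate subinterval of $J_p$. One-sided differentiability means existence of a finite one-sided derivative. "Almost everywhere" refers to Lebesgue measure. "Increasing" means strictly increasing. *)

theory Defs
  imports "HOL-Analysis.Analysis"
begin

(* Digit sequences are indexed from 0: the entry c i is the digit c_(i+1) of the usual
   one-based notation, hence the exponent Suc i. *)

definition base_value :: "real \<Rightarrow> (nat \<Rightarrow> nat) \<Rightarrow> real" where
  "base_value r c = (\<Sum>i. real (c i) / r ^ Suc i)"

definition J :: "real \<Rightarrow> real set" where
  "J r = base_value r ` {c. \<forall>i. c i \<in> {0, 1}}"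

fun greedy :: "real \<Rightarrow> real \<Rightarrow> nat \<Rightarrow> nat" where
  "greedy p x n =
     (if (\<Sum>i<n. real (greedy p x i) / p ^ Suc i) + 1 / p ^ Suc n \<le> x then 1 else 0)"

fun quasi_greedy :: "real \<Rightarrow> real \<Rightarrow> nat \<Rightarrow> nat" where
  "quasi_greedy p x n =
     (if x = 0 then 0
      else if (\<Sum>i<n. real (quasi_greedy p x i) / p ^ Suc i) + 1 / p ^ Suc n < x then 1 else 0)"

(* The unfolding equations loop as rewrite rules. *)
declare greedy.simps [simp del] quasi_greedy.simps [simp del]

(* Meaningful for x in J p; the values elsewhere are irrelevant. *)
definition base_change :: "real \<Rightarrow> real \<Rightarrow> real \<Rightarrow> real" where
  "base_change p q = base_value q \<circ> quasi_greedy p"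

(* Monotone is meant in the weak sense, in either direction. *)
definition nowhere_monotone_on :: "real set \<Rightarrow> (real \<Rightarrow> real) \<Rightarrow> bool" where
  "nowhere_monotone_on S f \<longleftrightarrow>
     (\<forall>I. is_interval I \<and> I \<subseteq> S \<and> (\<exists>u\<in>I. \<exists>v\<in>I. u < v)
          \<longrightarrow> \<not> mono_on I f \<and> \<not> antimono_on I f)"

end

theory Submission
  imports Defs
begin

text \<open>
  Write \<open>f\<close> for the base-change function and \<open>d\<close> for the first quasi-greedy digit of \<open>x\<close>. Deleting
  that digit gives the functional equation \<open>f x = (d + f (p * x - d)) / q\<close>, so the graph of \<open>f\<close>
  contains, arbitrarily close to the left of every positive point, copies of its initial piece
  contracted by \<open>1 / p ^ n\<close> horizontally and by \<open>1 / q ^ n\<close> vertically. For \<open>q < p\<close> the difference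
  quotients over these copies blow up.

  The greedy and quasi-greedy expansions of \<open>x\<close> differ only if one ends in \<open>1 0 0 ...\<close> and the other
  in \<open>0\<close> followed by the quasi-greedy expansion of 1; the jump of \<open>f\<close> is then a positive multiple of
  \<open>1 - f 1\<close>. Since the expansion of 1 has value 1 in base \<open>p\<close>, this is negative for \<open>q < p\<close> and
  positive for \<open>p < q\<close>.

  For \<open>p < q\<close> Lebesgue's theorem on monotone functions is avoided: for a base \<open>r\<close> strictly between \<open>p\<close>
  and \<open>q\<close>, the increments of the function with target base \<open>q\<close> are at most a constant times the
  power \<open>ln q / ln r > 1\<close> of those of the function with target base \<open>r\<close>. A bounded increasing function
  satisfies, at almost every point, a Hoelder condition with any exponent below 1. Hence \<open>f\<close> has
  derivative 0 almost everywhere.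
\<close>

section \<open>Values of digit sequences\<close>

lemma summable_base_value:
  fixes r :: real
  assumes "1 < r" "\<And>i. c i \<le> (1::nat)"
  shows "summable (\<lambda>i. real (c i) / r ^ Suc i)"
proof (rule summable_comparison_test')
  show "summable (\<lambda>i. (1 / r) ^ i)"
    using assms by (intro summable_geometric) auto
  fix n :: nat
  have "real (c n) / r ^ Suc n \<le> 1 / r ^ Suc n"
    using assms by (intro divide_right_mono) (auto simp: le_Suc_eq)
  also have "\<dots> \<le> 1 / r ^ n"
    using assms by (intro divide_left_mono) auto
  finally show "norm (real (c n) / r ^ Suc n) \<le> (1 / r) ^ n"
    using assms by (simp add: power_one_over)
qed

lemma base_value_nonneg: "1 < r \<Longrightarrow> (\<And>i. c i \<le> 1) \<Longrightarrow> 0 \<le> base_value r c"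
  unfolding base_value_def by (intro suminf_nonneg summable_base_value) auto

lemma base_value_le:
  assumes "1 < r" "\<And>i. c i \<le> 1"
  shows "base_value r c \<le> 1 / (r - 1)"
proof -
  have "(\<lambda>i. (1 / r) * (1 / r) ^ i) sums ((1 / r) * (1 / (1 - 1 / r)))"
    using assms by (intro sums_mult geometric_sums) auto
  moreover have "(1 / r) * (1 / (1 - 1 / r)) = 1 / (r - 1)"
    using assms by (simp add: field_simps)
  ultimately have s: "(\<lambda>i. 1 / r ^ Suc i) sums (1 / (r - 1))"
    by (simp add: power_one_over)
  have "base_value r c \<le> (\<Sum>i. 1 / r ^ Suc i)"
    unfolding base_value_def
  proof (intro suminf_le summable_base_value assms)
    show "summable (\<lambda>i. 1 / r ^ Suc i)" using s by (rule sums_summable)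
    show "real (c n) / r ^ Suc n \<le> 1 / r ^ Suc n" for n
      using assms by (intro divide_right_mono) (auto simp: le_Suc_eq)
  qed
  with s show ?thesis by (simp add: sums_iff)
qed

lemma base_value_split:
  assumes "1 < r" "\<And>i. c i \<le> 1"
  shows "base_value r c =
    (\<Sum>i<n. real (c i) / r ^ Suc i) + base_value r (\<lambda>i. c (i + n)) / r ^ n"
proof -
  have "base_value r c = (\<Sum>i. real (c (i + n)) / r ^ Suc (i + n)) + (\<Sum>i<n. real (c i) / r ^ Suc i)"
    unfolding base_value_def using summable_base_value[OF assms] by (rule suminf_split_initial_segment)
  also have "(\<Sum>i. real (c (i + n)) / r ^ Suc (i + n)) = (\<Sum>i. real (c (i + n)) / r ^ Suc i / r ^ n)"
    by (simp add: power_add mult.assoc)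
  also have "\<dots> = base_value r (\<lambda>i. c (i + n)) / r ^ n"
    unfolding base_value_def
    by (rule suminf_divide[OF summable_base_value]) (use assms in auto)
  finally show ?thesis by simp
qed

lemma base_value_zero: "base_value r (\<lambda>_. 0) = 0"
  by (simp add: base_value_def)

lemma base_value_agree:
  assumes "1 < r" "\<And>i. c i \<le> 1" "\<And>i. c' i \<le> 1" "\<And>i. i < n \<Longrightarrow> c i = c' i"
  shows "\<bar>base_value r c - base_value r c'\<bar> \<le> 1 / (r - 1) / r ^ n"
proof -
  let ?u = "base_value r (\<lambda>i. c (i + n))" and ?v = "base_value r (\<lambda>i. c' (i + n))"
  have "base_value r c - base_value r c' = (?u - ?v) / r ^ n"
    using assms(4) base_value_split[of r c n] base_value_split[of r c' n] assms
    by (simp add: diff_divide_distrib)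
  moreover have "\<bar>?u - ?v\<bar> \<le> 1 / (r - 1)"
    using base_value_nonneg[of r "\<lambda>i. c (i + n)"] base_value_nonneg[of r "\<lambda>i. c' (i + n)"]
      base_value_le[of r "\<lambda>i. c (i + n)"] base_value_le[of r "\<lambda>i. c' (i + n)"] assms by auto
  ultimately show ?thesis
    using assms(1) by (simp add: abs_divide divide_right_mono del: divide_divide_eq_left)
qed

text \<open>No term grows with the base, and the term of a nonzero digit strictly shrinks. Applied
  to the expansion of 1, this decides on which side of 1 the value \<open>f 1\<close> lies.\<close>

lemma base_value_strict_antimono:
  assumes "1 < r" "r < s" "\<And>i. c i \<le> 1" "c k = 1"
  shows "base_value s c < base_value r c"
proof -
  have sm: "summable (\<lambda>i. real (c i) / r ^ Suc i)" "summable (\<lambda>i. real (c i) / s ^ Suc i)"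
    using assms by (auto intro!: summable_base_value simp del: power_Suc)
  have "0 < (\<Sum>i. real (c i) / r ^ Suc i - real (c i) / s ^ Suc i)"
  proof (rule suminf_pos2)
    show "summable (\<lambda>i. real (c i) / r ^ Suc i - real (c i) / s ^ Suc i)"
      using sm by (rule summable_diff)
    show "0 \<le> real (c i) / r ^ Suc i - real (c i) / s ^ Suc i" for i
    proof -
      have "real (c i) / s ^ Suc i \<le> real (c i) / r ^ Suc i"
        using assms by (intro divide_left_mono power_mono mult_pos_pos zero_less_power) auto
      then show ?thesis by simp
    qed
    have "r ^ Suc k < s ^ Suc k"
      using assms by (intro power_strict_mono) auto
    then show "0 < real (c k) / r ^ Suc k - real (c k) / s ^ Suc k"
      using assms by (simp add: frac_less2 del: power_Suc)
  qed
  then show ?thesis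
    unfolding base_value_def by (simp add: suminf_diff[OF sm, symmetric] del: power_Suc)
qed

lemma tendsto_const_div_power:
  fixes r :: real
  assumes "1 < r"
  shows "(\<lambda>n. C / r ^ n) \<longlonglongrightarrow> 0"
  using tendsto_mult[OF tendsto_const[of C] LIMSEQ_realpow_zero[of "1 / r"]] assms
  by (simp add: power_one_over)

text \<open>The tail bound after \<open>N\<close> common digits is uniform in \<open>y\<close>, so
  one-sided limits of values reduce to eventual agreement of digits.\<close>

lemma tendsto_base_value:
  assumes "1 < r" "\<And>y i. C y i \<le> 1" "\<And>i. c i \<le> 1"
    and ev: "\<And>N. eventually (\<lambda>y. \<forall>i<N. C y i = c i) F"
  shows "((\<lambda>y. base_value r (C y)) \<longlongrightarrow> base_value r c) F"
proof (rule tendstoI)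
  fix e :: real assume "0 < e"
  have "eventually (\<lambda>n. 1 / (r - 1) / r ^ n < e) sequentially"
    using tendsto_const_div_power[OF assms(1)] \<open>0 < e\<close> by (rule order_tendstoD)
  then obtain N where N: "1 / (r - 1) / r ^ N < e"
    by (auto simp: eventually_sequentially)
  show "eventually (\<lambda>y. dist (base_value r (C y)) (base_value r c) < e) F"
    using ev[of N]
  proof eventually_elim
    case (elim y)
    then have "\<bar>base_value r (C y) - base_value r c\<bar> \<le> 1 / (r - 1) / r ^ N"
      using assms by (intro base_value_agree) auto
    with N show ?case by (simp add: dist_real_def)
  qed
qed

text \<open>\<open>R n\<close> is what is left of \<open>x\<close> after \<open>n\<close> digits,
  magnified by \<open>r ^ n\<close>. Boundedness of these remainders makes the partial sums converge
  to \<open>x\<close>.\<close>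

lemma base_value_eqI:
  fixes x r :: real
  assumes "1 < r" "\<And>i. c i \<le> 1"
    and "\<And>n. x = (\<Sum>i<n. real (c i) / r ^ Suc i) + R n / r ^ n"
    and "\<And>n. 0 \<le> R n" "\<And>n. R n \<le> K"
  shows "base_value r c = x"
proof -
  have "(\<lambda>n. R n / r ^ n) \<longlonglongrightarrow> 0"
  proof (rule tendsto_sandwich[OF _ _ tendsto_const tendsto_const_div_power[OF assms(1), of K]])
    show "eventually (\<lambda>n. 0 \<le> R n / r ^ n) sequentially"
      using assms by (auto intro!: always_eventually divide_nonneg_pos)
    show "eventually (\<lambda>n. R n / r ^ n \<le> K / r ^ n) sequentially"
      using assms by (auto intro!: always_eventually divide_right_mono)
  qed
  then have "(\<lambda>n. x - R n / r ^ n) \<longlonglongrightarrow> x - 0"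
    by (intro tendsto_diff tendsto_const)
  moreover have "x - R n / r ^ n = (\<Sum>i<n. real (c i) / r ^ Suc i)" for n
    using assms(3)[of n] by linarith
  ultimately have "(\<lambda>i. real (c i) / r ^ Suc i) sums x"
    by (simp add: sums_def)
  then show ?thesis by (simp add: base_value_def sums_iff)
qed

section \<open>Greedy and quasi-greedy digits\<close>

lemma greedy_le_1: "greedy p x n \<le> 1"
  by (subst greedy.simps) auto

lemma quasi_greedy_le_1: "quasi_greedy p x n \<le> 1"
  by (subst quasi_greedy.simps) auto

text \<open>Negative arguments are included so that base-change functions vanish on the negative
  axis; this lets monotonicity for \<open>p < q\<close> be stated on the whole line.\<close>

lemma quasi_greedy_nonpos:
  assumes "1 < p" "x \<le> 0"
  shows "quasi_greedy p x n = 0"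
proof -
  have "0 \<le> (\<Sum>i<n. real (quasi_greedy p x i) / p ^ Suc i)"
    using assms by (intro sum_nonneg) auto
  moreover have "0 < 1 / p ^ Suc n" using assms by simp
  ultimately have "\<not> (\<Sum>i<n. real (quasi_greedy p x i) / p ^ Suc i) + 1 / p ^ Suc n < x"
    using assms by linarith
  then show ?thesis
    by (subst quasi_greedy.simps) (simp del: power_Suc)
qed

lemma greedy_of_0:
  assumes "1 < p"
  shows "greedy p 0 n = 0"
proof -
  have "0 \<le> (\<Sum>i<n. real (greedy p 0 i) / p ^ Suc i)"
    using assms by (intro sum_nonneg) auto
  moreover have "0 < 1 / p ^ Suc n" using assms by simp
  ultimately have "\<not> (\<Sum>i<n. real (greedy p 0 i) / p ^ Suc i) + 1 / p ^ Suc n \<le> 0"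
    by linarith
  then show ?thesis
    by (subst greedy.simps) (simp del: power_Suc)
qed

lemma quasi_greedy_first_digit: "quasi_greedy p x 0 = (if x \<noteq> 0 \<and> 1 / p < x then 1 else 0)"
  by (subst quasi_greedy.simps) auto

lemma greedy_first_digit: "greedy p x 0 = (if 1 / p \<le> x then 1 else 0)"
  by (subst greedy.simps) auto

section \<open>Deleting leading digits\<close>

lemma sum_shift_digit:
  fixes p :: real
  shows "(\<Sum>i<Suc n. real (c i) / p ^ Suc i) = (real (c 0) + (\<Sum>i<n. real (c (Suc i)) / p ^ Suc i)) / p"
  by (subst sum.lessThan_Suc_shift) (simp add: add_divide_distrib sum_divide_distrib mult_ac)

text \<open>Multiplying the comparison for digit \<open>Suc n\<close> of \<open>x\<close> by
  \<open>p\<close> and subtracting the first digit gives the comparison for digit \<open>n\<close>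
  of the shifted number.\<close>

lemma quasi_greedy_Suc:
  assumes p: "1 < p"
  shows "quasi_greedy p x (Suc n) = quasi_greedy p (p * x - real (quasi_greedy p x 0)) n"
proof (induction n rule: less_induct)
  case (less n)
  let ?d = "real (quasi_greedy p x 0)"
  \<comment> \<open>The recursion treats 0 separately. A first digit 1 requires
    \<open>1 / p < x\<close> strictly, so deleting it never produces 0.\<close>
  have nz: "p * x - ?d = 0 \<longleftrightarrow> x = 0"
    using p by (auto simp: quasi_greedy_first_digit field_simps)
  let ?S = "\<Sum>i<n. real (quasi_greedy p (p * x - ?d) i) / p ^ Suc i"
  have "(\<Sum>i<Suc n. real (quasi_greedy p x i) / p ^ Suc i) = (?d + ?S) / p"
    unfolding sum_shift_digit using less by (simp del: power_Suc cong: sum.cong_simp)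
  moreover have "1 / p ^ Suc (Suc n) = 1 / p ^ Suc n / p"
    by simp
  ultimately have "(\<Sum>i<Suc n. real (quasi_greedy p x i) / p ^ Suc i) + 1 / p ^ Suc (Suc n) < x \<longleftrightarrow>
      (?d + (?S + 1 / p ^ Suc n)) / p < x"
    by (simp only: add_divide_distrib add.assoc)
  also have "\<dots> \<longleftrightarrow> ?S + 1 / p ^ Suc n < p * x - ?d"
    using p by (simp only: pos_divide_less_eq) (auto simp: algebra_simps)
  finally show ?case
    unfolding quasi_greedy.simps[of p x "Suc n"] quasi_greedy.simps[of p "p * x - ?d" n] nz
    by (simp only:)
qed

lemma greedy_Suc:
  assumes p: "1 < p"
  shows "greedy p x (Suc n) = greedy p (p * x - real (greedy p x 0)) n"
proof (induction n rule: less_induct)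
  case (less n)
  let ?d = "real (greedy p x 0)"
  let ?S = "\<Sum>i<n. real (greedy p (p * x - ?d) i) / p ^ Suc i"
  have "(\<Sum>i<Suc n. real (greedy p x i) / p ^ Suc i) = (?d + ?S) / p"
    unfolding sum_shift_digit using less by (simp del: power_Suc cong: sum.cong_simp)
  moreover have "1 / p ^ Suc (Suc n) = 1 / p ^ Suc n / p"
    by simp
  ultimately have "(\<Sum>i<Suc n. real (greedy p x i) / p ^ Suc i) + 1 / p ^ Suc (Suc n) \<le> x \<longleftrightarrow>
      (?d + (?S + 1 / p ^ Suc n)) / p \<le> x"
    by (simp only: add_divide_distrib add.assoc)
  also have "\<dots> \<longleftrightarrow> ?S + 1 / p ^ Suc n \<le> p * x - ?d"
    using p by (simp only: pos_divide_le_eq) (auto simp: algebra_simps)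
  finally show ?case
    unfolding greedy.simps[of p x "Suc n"] greedy.simps[of p "p * x - ?d" n]
    by (simp only:)
qed

lemma quasi_greedy_add:
  assumes p: "1 < p"
  shows "quasi_greedy p x (i + n) =
    quasi_greedy p (p ^ n * (x - (\<Sum>k<n. real (quasi_greedy p x k) / p ^ Suc k))) i"
proof (induction n arbitrary: i)
  case (Suc n)
  let ?S = "\<Sum>k<n. real (quasi_greedy p x k) / p ^ Suc k"
  have *: "quasi_greedy p x n = quasi_greedy p (p ^ n * (x - ?S)) 0"
    using Suc[of 0] by simp
  have **: "p ^ Suc n * (x - (\<Sum>k<Suc n. real (quasi_greedy p x k) / p ^ Suc k)) =
    p * (p ^ n * (x - ?S)) - real (quasi_greedy p x n)"
    using p by (simp add: field_simps)
  have "quasi_greedy p x (i + Suc n) = quasi_greedy p (p ^ n * (x - ?S)) (Suc i)"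
    using Suc[of "Suc i"] by simp
  also have "\<dots> = quasi_greedy p (p * (p ^ n * (x - ?S)) - real (quasi_greedy p x n)) i"
    by (simp only: quasi_greedy_Suc[OF p] *)
  finally show ?case by (simp only: **)
qed simp

lemma greedy_add:
  assumes p: "1 < p"
  shows "greedy p x (i + n) =
    greedy p (p ^ n * (x - (\<Sum>k<n. real (greedy p x k) / p ^ Suc k))) i"
proof (induction n arbitrary: i)
  case (Suc n)
  let ?S = "\<Sum>k<n. real (greedy p x k) / p ^ Suc k"
  have *: "greedy p x n = greedy p (p ^ n * (x - ?S)) 0"
    using Suc[of 0] by simp
  have **: "p ^ Suc n * (x - (\<Sum>k<Suc n. real (greedy p x k) / p ^ Suc k)) =
    p * (p ^ n * (x - ?S)) - real (greedy p x n)"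
    using p by (simp add: field_simps)
  have "greedy p x (i + Suc n) = greedy p (p ^ n * (x - ?S)) (Suc i)"
    using Suc[of "Suc i"] by simp
  also have "\<dots> = greedy p (p * (p ^ n * (x - ?S)) - real (greedy p x n)) i"
    by (simp only: greedy_Suc[OF p] *)
  finally show ?case by (simp only: **)
qed simp

section \<open>Remainders and the range of expansions\<close>

text \<open>A remainder \<open>t\<close> becomes \<open>p * t\<close> or \<open>p * t - 1\<close>.
  The upper bound is the fixed point of the second map, and \<open>p \<le> 2\<close> makes it at
  least 1, which covers the first. The strict comparison keeps remainders positive.\<close>

lemma quasi_greedy_remainder:
  assumes p: "1 < p" "p \<le> 2" and x: "0 < x" "x \<le> 1 / (p - 1)"
  defines "R \<equiv> \<lambda>n. p ^ n * (x - (\<Sum>k<n. real (quasi_greedy p x k) / p ^ Suc k))"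
  shows "0 < R n \<and> R n \<le> 1 / (p - 1)"
proof (induction n)
  case 0
  then show ?case using x by (simp add: R_def)
next
  case (Suc n)
  have "R (Suc n) = p * R n - real (quasi_greedy p x n)"
    using p by (simp add: R_def field_simps)
  also have "quasi_greedy p x n = quasi_greedy p (R n) 0"
    using quasi_greedy_add[OF p(1), of x 0 n] by (simp add: R_def)
  also have "\<dots> = (if 1 < p * R n then 1 else 0)"
    using Suc p by (auto simp: quasi_greedy_first_digit field_simps)
  finally have *: "R (Suc n) = p * R n - (if 1 < p * R n then 1 else 0)"
    by (simp split: if_splits)
  have "1 \<le> 1 / (p - 1)" "p * (1 / (p - 1)) - 1 = 1 / (p - 1)"
    using p by (simp_all add: field_simps)
  moreover have "p * R n \<le> p * (1 / (p - 1))"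
    using Suc p by (intro mult_left_mono) auto
  moreover have "0 < p * R n" using Suc p by simp
  ultimately show ?case unfolding * by (auto split: if_splits)
qed

lemma greedy_remainder:
  assumes p: "1 < p" "p \<le> 2" and x: "0 \<le> x" "x \<le> 1 / (p - 1)"
  defines "R \<equiv> \<lambda>n. p ^ n * (x - (\<Sum>k<n. real (greedy p x k) / p ^ Suc k))"
  shows "0 \<le> R n \<and> R n \<le> 1 / (p - 1)"
proof (induction n)
  case 0
  then show ?case using x by (simp add: R_def)
next
  case (Suc n)
  have "R (Suc n) = p * R n - real (greedy p x n)"
    using p by (simp add: R_def field_simps)
  also have "greedy p x n = greedy p (R n) 0"
    using greedy_add[OF p(1), of x 0 n] by (simp add: R_def)
  also have "\<dots> = (if 1 \<le> p * R n then 1 else 0)"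
    using Suc p by (auto simp: greedy_first_digit field_simps)
  finally have *: "R (Suc n) = p * R n - (if 1 \<le> p * R n then 1 else 0)"
    by (simp split: if_splits)
  have "1 \<le> 1 / (p - 1)" "p * (1 / (p - 1)) - 1 = 1 / (p - 1)"
    using p by (simp_all add: field_simps)
  moreover have "p * R n \<le> p * (1 / (p - 1))"
    using Suc p by (intro mult_left_mono) auto
  moreover have "0 \<le> p * R n" using Suc p by simp
  ultimately show ?case unfolding * by (auto split: if_splits)
qed

lemma base_value_quasi_greedy:
  assumes p: "1 < p" "p \<le> 2" and x: "0 \<le> x" "x \<le> 1 / (p - 1)"
  shows "base_value p (quasi_greedy p x) = x"
proof (cases "x = 0")
  case True
  then show ?thesis
    using p quasi_greedy_nonpos[of p x] by (simp add: base_value_def)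
next
  case False
  with x have "0 < x" by simp
  show ?thesis
    by (rule base_value_eqI[where K = "1 / (p - 1)" and
        R = "\<lambda>n. p ^ n * (x - (\<Sum>k<n. real (quasi_greedy p x k) / p ^ Suc k))"])
      (use p quasi_greedy_remainder[OF p \<open>0 < x\<close> x(2)] in
        \<open>auto simp: less_imp_le quasi_greedy_le_1 simp del: power_Suc One_nat_def\<close>)
qed

lemma base_value_greedy:
  assumes p: "1 < p" "p \<le> 2" and x: "0 \<le> x" "x \<le> 1 / (p - 1)"
  shows "base_value p (greedy p x) = x"
  by (rule base_value_eqI[where K = "1 / (p - 1)" and
        R = "\<lambda>n. p ^ n * (x - (\<Sum>k<n. real (greedy p x k) / p ^ Suc k))"])
    (use p greedy_remainder[OF p x] in
      \<open>auto simp: less_imp_le greedy_le_1 simp del: power_Suc One_nat_def\<close>)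

lemma J_eq:
  assumes p: "1 < p" "p \<le> 2"
  shows "J p = {0..1 / (p - 1)}"
proof
  show "J p \<subseteq> {0..1 / (p - 1)}"
  proof
    fix x assume "x \<in> J p"
    then obtain c where c: "x = base_value p c" "\<And>i. c i \<in> {0, 1}"
      unfolding J_def by auto
    have "c i \<le> 1" for i using c(2)[of i] by auto
    with c p show "x \<in> {0..1 / (p - 1)}"
      by (simp add: base_value_nonneg base_value_le)
  qed
  show "{0..1 / (p - 1)} \<subseteq> J p"
  proof
    fix x assume "x \<in> {0..1 / (p - 1)}"
    then have "base_value p (quasi_greedy p x) = x"
      using p by (intro base_value_quasi_greedy) auto
    moreover have "quasi_greedy p x i \<in> {0, 1}" for i
      using quasi_greedy_le_1[of p x i] by auto
    ultimately show "x \<in> J p"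
      unfolding J_def by (intro image_eqI[of x _ "quasi_greedy p x"]) auto
  qed
qed

section \<open>Digits of neighbouring points\<close>

lemma quasi_greedy_prefix_eqI:
  assumes "z \<noteq> 0"
    and c: "\<And>i. i < n \<Longrightarrow> c i = (if (\<Sum>k<i. real (c k) / p ^ Suc k) + 1 / p ^ Suc i < z then 1 else 0)"
    and "i < n"
  shows "quasi_greedy p z i = c i"
  using \<open>i < n\<close>
proof (induction i rule: less_induct)
  case (less i)
  have "(\<Sum>k<i. real (quasi_greedy p z k) / p ^ Suc k) = (\<Sum>k<i. real (c k) / p ^ Suc k)"
    using less by (intro sum.cong) auto
  then show ?case
    unfolding quasi_greedy.simps[of p z i] c[OF less(2)] using \<open>z \<noteq> 0\<close> by (simp del: power_Suc)
qed

text \<open>Each comparison is stable when \<open>x\<close> decreases slightly: a strict inequality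
  is an open condition, and a failed one fails for all smaller points.\<close>

lemma eventually_quasi_greedy_at_left:
  assumes "0 < x"
  shows "eventually (\<lambda>y. \<forall>i<N. quasi_greedy p y i = quasi_greedy p x i) (at_left x)"
proof (induction N)
  case (Suc N)
  let ?S = "(\<Sum>i<N. real (quasi_greedy p x i) / p ^ Suc i) + 1 / p ^ Suc N"
  have "eventually (\<lambda>y. y \<noteq> 0 \<and> (?S < y \<longleftrightarrow> ?S < x)) (at_left x)"
  proof -
    have 1: "eventually (\<lambda>y. 0 < y) (at_left x)"
      using assms by (intro order_tendstoD(1)[OF tendsto_ident_at])
    have 2: "eventually (\<lambda>y. y < x) (at_left x)"
      by (simp add: eventually_at_filter)
    show ?thesis
    proof (cases "?S < x")
      case True
      then have 3: "eventually (\<lambda>y. ?S < y) (at_left x)"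
        by (intro order_tendstoD(1)[OF tendsto_ident_at])
      from 1 3 show ?thesis by eventually_elim (use True in auto)
    next
      case False
      from 1 2 show ?thesis by eventually_elim (use False in linarith)
    qed
  qed
  with Suc show ?case
  proof eventually_elim
    case (elim y)
    then have "(\<Sum>i<N. real (quasi_greedy p y i) / p ^ Suc i) = (\<Sum>i<N. real (quasi_greedy p x i) / p ^ Suc i)"
      by (intro sum.cong) auto
    with elim have "quasi_greedy p y N = quasi_greedy p x N"
      using assms unfolding quasi_greedy.simps[of p y N] quasi_greedy.simps[of p x N]
      by (simp del: power_Suc)
    with elim show ?case by (auto simp: less_Suc_eq)
  qed
qed simp

text \<open>For \<open>y\<close> slightly above \<open>x\<close>, the strict comparison with
  \<open>y\<close> agrees with the weak comparison with \<open>x\<close>. Hence the digits seen from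
  the right are the greedy ones.\<close>

lemma eventually_quasi_greedy_at_right:
  assumes "0 \<le> x"
  shows "eventually (\<lambda>y. \<forall>i<N. quasi_greedy p y i = greedy p x i) (at_right x)"
proof (induction N)
  case (Suc N)
  let ?S = "(\<Sum>i<N. real (greedy p x i) / p ^ Suc i) + 1 / p ^ Suc N"
  have "eventually (\<lambda>y. y \<noteq> 0 \<and> (?S < y \<longleftrightarrow> ?S \<le> x)) (at_right x)"
  proof -
    have 1: "eventually (\<lambda>y. x < y) (at_right x)"
      by (simp add: eventually_at_filter)
    show ?thesis
    proof (cases "?S \<le> x")
      case True
      from 1 show ?thesis by eventually_elim (use True assms in auto)
    next
      case False
      then have 3: "eventually (\<lambda>y. y < ?S) (at_right x)"
        by (intro order_tendstoD(2)[OF tendsto_ident_at]) simp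
      from 1 3 show ?thesis by eventually_elim (use False assms in auto)
    qed
  qed
  with Suc show ?case
  proof eventually_elim
    case (elim y)
    then have "(\<Sum>i<N. real (quasi_greedy p y i) / p ^ Suc i) = (\<Sum>i<N. real (greedy p x i) / p ^ Suc i)"
      by (intro sum.cong) auto
    with elim have "quasi_greedy p y N = greedy p x N"
      unfolding quasi_greedy.simps[of p y N] greedy.simps[of p x N]
      by (simp del: power_Suc)
    with elim show ?case by (auto simp: less_Suc_eq)
  qed
qed simp

lemma differentiable_imp_local_bound:
  fixes f :: "real \<Rightarrow> real"
  assumes "f differentiable (at x within S)"
  obtains B where "0 < B" "eventually (\<lambda>y. \<bar>f y - f x\<bar> \<le> B * \<bar>y - x\<bar>) (at x within S)"
proof -
  obtain D where "((\<lambda>y. (f y - f x) / (y - x)) \<longlongrightarrow> D) (at x within S)"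
    using assms unfolding real_differentiable_def has_field_derivative_iff by auto
  then have "((\<lambda>y. \<bar>(f y - f x) / (y - x)\<bar>) \<longlongrightarrow> \<bar>D\<bar>) (at x within S)"
    by (rule tendsto_rabs)
  then have ev: "eventually (\<lambda>y. \<bar>(f y - f x) / (y - x)\<bar> < \<bar>D\<bar> + 1) (at x within S)"
    by (rule order_tendstoD) simp
  have ne: "eventually (\<lambda>y. y \<noteq> x) (at x within S)"
    by (simp add: eventually_at_filter)
  show thesis
  proof
    show "0 < \<bar>D\<bar> + 1" by simp
    show "eventually (\<lambda>y. \<bar>f y - f x\<bar> \<le> (\<bar>D\<bar> + 1) * \<bar>y - x\<bar>) (at x within S)"
      using ev ne
    proof eventually_elim
      case (elim y)
      then have "\<bar>f y - f x\<bar> / \<bar>y - x\<bar> \<le> \<bar>D\<bar> + 1" by (simp add: abs_divide)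
      then show ?case using elim by (simp add: pos_divide_le_eq)
    qed
  qed
qed

section \<open>The base-change function\<close>

locale base_pair =
  fixes p q :: real
  assumes p: "1 < p" "p \<le> 2" and q: "1 < q"
begin

abbreviation f :: "real \<Rightarrow> real" where "f \<equiv> base_change p q"

lemma f_split:
  "f z = (\<Sum>i<n. real (quasi_greedy p z i) / q ^ Suc i) +
     f (p ^ n * (z - (\<Sum>k<n. real (quasi_greedy p z k) / p ^ Suc k))) / q ^ n"
  unfolding base_change_def comp_def
  by (subst base_value_split[of q "quasi_greedy p z" n])
    (simp_all add: q quasi_greedy_le_1 quasi_greedy_add[OF p(1)] del: One_nat_def power_Suc)

lemma f_low: "z \<le> 1 / p \<Longrightarrow> f z = f (p * z) / q"
  using f_split[of z 1] by (simp add: quasi_greedy_first_digit)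

lemma f_high:
  assumes "1 / p < z"
  shows "f z = (1 + f (p * z - 1)) / q"
proof -
  have "z \<noteq> 0" using assms p by auto
  then show ?thesis using f_split[of z 1] assms p
    by (simp add: quasi_greedy_first_digit add_divide_distrib algebra_simps)
qed

lemma f_nonneg: "0 \<le> f z"
  by (simp add: base_change_def base_value_nonneg q quasi_greedy_le_1 del: One_nat_def)

lemma f_le: "f z \<le> 1 / (q - 1)"
  by (simp add: base_change_def base_value_le q quasi_greedy_le_1 del: One_nat_def)

lemma f_nonpos: "z \<le> 0 \<Longrightarrow> f z = 0"
  using p by (simp add: base_change_def base_value_def quasi_greedy_nonpos)

lemma one_le_L: "1 \<le> 1 / (p - 1)"
  using p by simp

lemma base_value_quasi_greedy_1: "base_value p (quasi_greedy p 1) = 1"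
  using p one_le_L by (intro base_value_quasi_greedy) auto

lemma quasi_greedy_1_0: "quasi_greedy p 1 0 = 1"
  using p by (simp add: quasi_greedy_first_digit)

lemma f_1_less: "p < q \<Longrightarrow> f 1 < 1"
  using base_value_strict_antimono[of p q "quasi_greedy p 1" 0] p quasi_greedy_1_0
  by (simp add: base_change_def base_value_quasi_greedy_1 quasi_greedy_le_1 del: One_nat_def)

lemma f_1_greater: "q < p \<Longrightarrow> 1 < f 1"
  using base_value_strict_antimono[of q p "quasi_greedy p 1" 0] q quasi_greedy_1_0
  by (simp add: base_change_def base_value_quasi_greedy_1 quasi_greedy_le_1 del: One_nat_def)

lemma f_1_pos: "0 < f 1"
proof -
  have "f 1 = (1 + f (p - 1)) / q"
    using f_high[of 1] p by simp
  then show ?thesis using f_nonneg[of "p - 1"] q by (simp add: divide_pos_pos add_pos_nonneg)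
qed

text \<open>\<open>1 / p ^ n\<close> has \<open>n\<close> leading zeros followed by the expansion of
  1. These points serve as explicit test points below.\<close>

lemma f_inverse_power: "f (1 / p ^ n) = f 1 / q ^ n"
proof (induction n)
  case (Suc n)
  have "f (1 / p ^ Suc n) = f (p * (1 / p ^ Suc n)) / q"
    using p by (intro f_low) (simp add: field_simps)
  then show ?case using Suc p by (simp add: mult_ac)
qed simp

text \<open>\<open>P\<close> and \<open>Q\<close> are the values of the first \<open>n\<close>
  digits of \<open>x\<close> in the bases \<open>p\<close> and \<open>q\<close>, and
  \<open>R\<close> is the magnified remainder. Points above \<open>P\<close> and up to
  \<open>x\<close> share these digits: they are large enough for the ones of \<open>x\<close> and
  too small for a further one. The condition \<open>1 / p < R\<close> makes every copy contain the
  image of the fixed interval up to \<open>1 / p\<close>.\<close>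

lemma small_copies:
  assumes x: "0 < x" "x \<le> 1 / (p - 1)"
  obtains n R P Q where "N \<le> n" "1 / p < R" "R \<le> 1 / (p - 1)" "x = P + R / p ^ n"
    "\<forall>w\<in>{0<..R}. f (P + w / p ^ n) = Q + f w / q ^ n"
proof -
  define P where "P n = (\<Sum>k<n. real (quasi_greedy p x k) / p ^ Suc k)" for n
  define R where "R n = p ^ n * (x - P n)" for n
  have R: "0 < R n" "R n \<le> 1 / (p - 1)" for n
    using quasi_greedy_remainder[OF p x, of n] by (auto simp: R_def P_def)
  have digit: "quasi_greedy p x n = (if 1 / p < R n then 1 else 0)" for n
  proof -
    have "quasi_greedy p x n = quasi_greedy p (R n) 0"
      using quasi_greedy_add[OF p(1), of x 0 n] by (simp add: R_def P_def)
    then show ?thesis using R(1)[of n] by (simp add: quasi_greedy_first_digit)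
  qed
  have x_eq: "x = P n + R n / p ^ n" for n
    using p by (simp add: R_def)
  \<comment> \<open>Otherwise all digits from \<open>N\<close> on vanish and the remainder grows by
    the factor \<open>p\<close> at each step, although it is bounded by
    \<open>1 / (p - 1)\<close>.\<close>
  have "\<exists>n\<ge>N. 1 / p < R n"
  proof (rule ccontr)
    assume "\<not> ?thesis"
    then have small: "R n \<le> 1 / p" if "N \<le> n" for n
      using that by force
    have "R (N + k) = p ^ k * R N" for k
    proof (induction k)
      case (Suc k)
      have "P (Suc (N + k)) = P (N + k)"
        using small[of "N + k"] digit[of "N + k"] by (simp add: P_def)
      then show ?case using Suc by (simp add: R_def)
    qed simp
    then have "R N \<le> 1 / (p - 1) / p ^ k" for k
      using R(2)[of "N + k"] p by (simp add: pos_le_divide_eq mult.commute del: divide_divide_eq_left)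
    then have "R N \<le> 0"
      by (intro tendsto_lowerbound[OF tendsto_const_div_power[OF p(1), of "1 / (p - 1)"]]
          always_eventually) auto
    with R(1)[of N] show False by simp
  qed
  then obtain n where n: "N \<le> n" "1 / p < R n" by auto
  have "f (P n + w / p ^ n) = (\<Sum>i<n. real (quasi_greedy p x i) / q ^ Suc i) + f w / q ^ n"
    if w: "0 < w" "w \<le> R n" for w
  proof -
    let ?z = "P n + w / p ^ n"
    have "0 \<le> P n" using p unfolding P_def by (intro sum_nonneg) auto
    then have z: "0 < ?z" using w p by (simp add: add_nonneg_pos)
    have "w / p ^ n \<le> R n / p ^ n" using w p by (intro divide_right_mono) auto
    then have zx: "?z \<le> x" using x_eq[of n] by linarith
    \<comment> \<open>At a digit 1 of \<open>x\<close> the threshold is \<open>P (Suc i)\<close>, at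
      most \<open>P n\<close> and hence strictly below \<open>?z\<close>; at a digit 0 the threshold
      is at least \<open>x\<close>, hence at least \<open>?z\<close>.\<close>
    have dig: "quasi_greedy p ?z i = quasi_greedy p x i" if "i < n" for i
    proof (rule quasi_greedy_prefix_eqI[OF _ _ that])
      show "?z \<noteq> 0" using z by simp
      fix i assume i: "i < n"
      have mono: "P (Suc i) \<le> P n"
        using i p unfolding P_def by (intro sum_mono2) auto
      have "P i + 1 / p ^ Suc i < x \<longleftrightarrow> P i + 1 / p ^ Suc i < ?z"
      proof
        assume "P i + 1 / p ^ Suc i < x"
        then have "quasi_greedy p x i = 1"
          using x unfolding quasi_greedy.simps[of p x i] P_def by (simp del: power_Suc)
        then have "P (Suc i) = P i + 1 / p ^ Suc i" by (simp add: P_def)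
        moreover have "0 < w / p ^ n" using w p by simp
        ultimately show "P i + 1 / p ^ Suc i < ?z" using mono by linarith
      next
        assume "P i + 1 / p ^ Suc i < ?z"
        with zx show "P i + 1 / p ^ Suc i < x" by linarith
      qed
      then show "quasi_greedy p x i = (if (\<Sum>k<i. real (quasi_greedy p x k) / p ^ Suc k) + 1 / p ^ Suc i < ?z then 1 else 0)"
        using x unfolding quasi_greedy.simps[of p x i] P_def by (simp del: power_Suc)
    qed
    then have "(\<Sum>k<n. real (quasi_greedy p ?z k) / p ^ Suc k) = P n"
      "(\<Sum>k<n. real (quasi_greedy p ?z k) / q ^ Suc k) = (\<Sum>k<n. real (quasi_greedy p x k) / q ^ Suc k)"
      unfolding P_def by (auto intro!: sum.cong simp del: power_Suc)
    with f_split[of ?z n] show ?thesis using p by (simp del: power_Suc)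
  qed
  with n R(2)[of n] x_eq[of n] show thesis by (intro ballI that[of n "R n" "P n" "\<Sum>i<n. real (quasi_greedy p x i) / q ^ Suc i"]) auto
qed

section \<open>One-sided continuity\<close>

lemma at_left_J:
  assumes "0 < x" "x \<le> 1 / (p - 1)"
  shows "at x within J p \<inter> {..<x} = at_left x"
  unfolding J_eq[OF p] using assms by (intro at_within_nhd[where S = "{0<..}"]) auto

lemma at_right_J:
  assumes "0 \<le> x" "x < 1 / (p - 1)"
  shows "at x within J p \<inter> {x<..} = at_right x"
  unfolding J_eq[OF p] using assms by (intro at_within_nhd[where S = "{..<1 / (p - 1)}"]) auto

lemma tendsto_f_at_left:
  assumes "0 < x"
  shows "(f \<longlongrightarrow> f x) (at_left x)"
  unfolding base_change_def comp_def
  by (rule tendsto_base_value[OF q quasi_greedy_le_1 quasi_greedy_le_1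
        eventually_quasi_greedy_at_left[OF assms]])

lemma tendsto_f_at_right:
  assumes "0 \<le> x"
  shows "(f \<longlongrightarrow> base_value q (greedy p x)) (at_right x)"
  unfolding base_change_def comp_def
  by (rule tendsto_base_value[OF q quasi_greedy_le_1 greedy_le_1
        eventually_quasi_greedy_at_right[OF assms]])

lemma continuous_left:
  assumes "x \<in> J p"
  shows "continuous (at x within J p \<inter> {..<x}) f"
proof (cases "x = 0")
  case True
  then have "J p \<inter> {..<x} = {}" by (auto simp: J_eq[OF p])
  then show ?thesis by simp
next
  case False
  with assms have "0 < x" "x \<le> 1 / (p - 1)" by (auto simp: J_eq[OF p])
  then show ?thesis
    using tendsto_f_at_left by (simp add: continuous_within at_left_J)
qed

text \<open>At the first disagreement \<open>x\<close> is a finite sum ending in a 1. The two values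
  in base \<open>q\<close> then differ by a nonzero multiple of \<open>1 - f 1\<close>, so their
  equality would force \<open>f 1 = 1\<close>, which \<open>p \<noteq> q\<close> excludes.\<close>

lemma greedy_eq_quasi_greedyI:
  assumes "p \<noteq> q" "0 \<le> x" and eq: "base_value q (greedy p x) = f x"
  shows "quasi_greedy p x = greedy p x"
proof (rule ccontr)
  assume "quasi_greedy p x \<noteq> greedy p x"
  then have ex: "\<exists>n. quasi_greedy p x n \<noteq> greedy p x n" by auto
  define n where "n = (LEAST n. quasi_greedy p x n \<noteq> greedy p x n)"
  have n: "quasi_greedy p x n \<noteq> greedy p x n"
    unfolding n_def using ex by (rule LeastI_ex)
  have less: "quasi_greedy p x i = greedy p x i" if "i < n" for i
    using not_less_Least[of i] that unfolding n_def by blast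
  have "x \<noteq> 0" using n p by (auto simp: greedy_of_0 quasi_greedy_nonpos)
  define S where "S = (\<Sum>i<n. real (greedy p x i) / p ^ Suc i)"
  define Sq where "Sq = (\<Sum>i<n. real (greedy p x i) / q ^ Suc i)"
  have S: "(\<Sum>i<n. real (quasi_greedy p x i) / p ^ Suc i) = S"
    unfolding S_def using less by (intro sum.cong) auto
  have Sq: "(\<Sum>i<n. real (quasi_greedy p x i) / q ^ Suc i) = Sq"
    unfolding Sq_def using less by (intro sum.cong) auto
  have "(S + 1 / p ^ Suc n < x) \<noteq> (S + 1 / p ^ Suc n \<le> x)"
    using n \<open>x \<noteq> 0\<close> unfolding quasi_greedy.simps[of p x n] greedy.simps[of p x n] S S_def[symmetric]
    by auto
  then have x: "x = S + 1 / p ^ Suc n" by linarith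
  have qg: "quasi_greedy p x n = 0"
    unfolding quasi_greedy.simps[of p x n] S using x by (simp del: power_Suc)
  have g: "greedy p x n = 1"
    unfolding greedy.simps[of p x n] S_def[symmetric] using x by (simp del: power_Suc)
  \<comment> \<open>After the common digits and the quasi-greedy digit 0, the magnified remainder is
    exactly 1; this is the source of \<open>f 1\<close>.\<close>
  have diff: "p ^ Suc n * (x - S) = 1"
  proof -
    have "x - S = 1 / p ^ Suc n" using x by linarith
    then show ?thesis using p by (simp only:) simp
  qed
  have "f x = Sq + f 1 / q ^ Suc n"
    using f_split[of x "Suc n"] unfolding sum.lessThan_Suc S Sq qg by (simp add: diff del: power_Suc)
  moreover have "base_value q (greedy p x) = Sq + 1 / q ^ Suc n"
  proof -
    have "x - (\<Sum>k<Suc n. real (greedy p x k) / p ^ Suc k) = 0"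
      using x unfolding sum.lessThan_Suc g S_def[symmetric] of_nat_1 by linarith
    then have "greedy p x (i + Suc n) = 0" for i
      unfolding greedy_add[OF p(1)] mult_zero_right by (simp only: mult_zero_right greedy_of_0[OF p(1)])
    then have "base_value q (\<lambda>i. greedy p x (i + Suc n)) = 0"
      by (simp only: base_value_zero)
    moreover have "base_value q (greedy p x) = (\<Sum>i<Suc n. real (greedy p x i) / q ^ Suc i) +
        base_value q (\<lambda>i. greedy p x (i + Suc n)) / q ^ Suc n"
      by (rule base_value_split[OF q greedy_le_1])
    ultimately show ?thesis
      unfolding sum.lessThan_Suc g Sq_def[symmetric] by simp
  qed
  ultimately have "f 1 = 1" using eq q by simp
  with f_1_less f_1_greater \<open>p \<noteq> q\<close> show False by fastforce
qed

lemma continuous_right_iff: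
  assumes "p \<noteq> q" "x \<in> {0..<1 / (p - 1)}"
  shows "continuous (at x within J p \<inter> {x<..}) f \<longleftrightarrow> quasi_greedy p x = greedy p x"
proof -
  have x: "0 \<le> x" "x < 1 / (p - 1)" using assms by auto
  note lim = tendsto_f_at_right[OF x(1)]
  have "continuous (at x within J p \<inter> {x<..}) f \<longleftrightarrow> (f \<longlongrightarrow> f x) (at_right x)"
    by (simp add: continuous_within at_right_J x)
  also have "\<dots> \<longleftrightarrow> base_value q (greedy p x) = f x"
    using lim by (metis tendsto_unique trivial_limit_at_right_real)
  also have "\<dots> \<longleftrightarrow> quasi_greedy p x = greedy p x"
    using greedy_eq_quasi_greedyI[OF assms(1) x(1)] by (auto simp: base_change_def)
  finally show ?thesis .
qed

section \<open>Irregularity for a smaller target base\<close>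

text \<open>In a copy at scale \<open>n\<close>, two points have images a distance
  \<open>d / q ^ n\<close> apart, while both lie within \<open>L / p ^ n\<close> of
  \<open>x\<close>. Since \<open>q < p\<close>, this contradicts a linear bound.\<close>

lemma not_left_differentiable:
  assumes "q < p" and x: "0 < x" "x \<le> 1 / (p - 1)"
  shows "\<not> f differentiable (at x within J p \<inter> {..<x})"
proof
  assume "f differentiable (at x within J p \<inter> {..<x})"
  then obtain B where B: "0 < B" "eventually (\<lambda>y. \<bar>f y - f x\<bar> \<le> B * \<bar>y - x\<bar>) (at_left x)"
    unfolding at_left_J[OF x] by (rule differentiable_imp_local_bound)
  then obtain b where b: "b < x" "\<And>y. b < y \<Longrightarrow> y < x \<Longrightarrow> \<bar>f y - f x\<bar> \<le> B * \<bar>y - x\<bar>"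
    unfolding eventually_at_left_field by auto
  define L where "L = 1 / (p - 1)"
  define d where "d = f (1 / p) - f (1 / p ^ 2)"
  have "d = f 1 / q * (1 - 1 / q)"
    using f_inverse_power[of 1] f_inverse_power[of 2] q by (simp add: d_def field_simps power2_eq_square)
  moreover have "0 < f 1 / q" "0 < 1 - 1 / q"
    using f_1_pos q by auto
  ultimately have "0 < d" by (metis mult_pos_pos)
  have "eventually (\<lambda>n. L / p ^ n < x - b) sequentially"
    using tendsto_const_div_power[OF p(1), of L] b(1) by (intro order_tendstoD(2)) auto
  moreover have "eventually (\<lambda>n. 2 * B * L / (p / q) ^ n < d) sequentially"
    using tendsto_const_div_power[of "p / q" "2 * B * L"] assms(1) q \<open>0 < d\<close>
    by (intro order_tendstoD(2)) auto
  ultimately obtain N where N: "\<And>n. N \<le> n \<Longrightarrow> L / p ^ n < x - b"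
    "\<And>n. N \<le> n \<Longrightarrow> 2 * B * L / (p / q) ^ n < d"
    unfolding eventually_sequentially by (metis nle_le order_trans)
  obtain n R P Q where copy: "N \<le> n" "1 / p < R" "R \<le> L" "x = P + R / p ^ n"
    "\<forall>w\<in>{0<..R}. f (P + w / p ^ n) = Q + f w / q ^ n"
    unfolding L_def by (rule small_copies[OF x, of N])
  have "0 < R" using copy p by (smt (verit) divide_pos_pos)
  have bound: "\<bar>f w - f R\<bar> \<le> B * L / (p / q) ^ n" if w: "0 < w" "w \<le> 1 / p" for w
  proof -
    have "(R - w) / p ^ n \<le> L / p ^ n"
      using copy w p by (intro divide_right_mono) auto
    moreover have "x - (P + w / p ^ n) = (R - w) / p ^ n"
      using copy(4) by (simp add: diff_divide_distrib)
    moreover have "0 < (R - w) / p ^ n" using w copy(2) p by simp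
    ultimately have y: "b < P + w / p ^ n" "P + w / p ^ n < x" "\<bar>P + w / p ^ n - x\<bar> \<le> L / p ^ n"
      using N(1)[OF copy(1)] by linarith+
    have "\<bar>f w - f R\<bar> / q ^ n = \<bar>f (P + w / p ^ n) - f x\<bar>"
      using copy(5)[THEN bspec, of w] copy(5)[THEN bspec, of R] w copy(2,4) q \<open>0 < R\<close>
      by (simp add: diff_divide_distrib[symmetric] abs_divide)
    also have "\<dots> \<le> B * (L / p ^ n)"
      using b(2)[OF y(1,2)] y(3) B(1) by (meson mult_left_mono less_imp_le order_trans)
    finally show ?thesis
      using p q by (simp add: field_simps power_divide)
  qed
  \<comment> \<open>The endpoint \<open>R\<close> of the copy corresponds to \<open>x\<close>
    itself, so both increments are measured against \<open>f x\<close>.\<close>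
  have "\<bar>d\<bar> \<le> \<bar>f (1 / p) - f R\<bar> + \<bar>f (1 / p ^ 2) - f R\<bar>"
    unfolding d_def by linarith
  also have "\<dots> \<le> B * L / (p / q) ^ n + B * L / (p / q) ^ n"
    using p by (intro add_mono bound) (auto simp: power2_eq_square field_simps)
  also have "\<dots> < d" using N(2)[OF copy(1)] by simp
  finally show False by simp
qed

text \<open>The points \<open>x + 1 / p ^ m\<close> keep the finite expansion of \<open>x\<close> as
  a prefix and have the value \<open>S + f 1 / q ^ m\<close> for large \<open>m\<close>. A linear
  bound first forces \<open>S = f x\<close> and then contradicts \<open>q < p\<close>.\<close>

lemma not_right_differentiable:
  assumes "q < p" and x: "x \<in> J p" and fin: "finite {i. greedy p x i \<noteq> 0}"
  shows "\<not> f differentiable (at x within J p \<inter> {x<..})"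
proof
  assume diff: "f differentiable (at x within J p \<inter> {x<..})"
  obtain N where N: "\<And>i. N \<le> i \<Longrightarrow> greedy p x i = 0"
    using finite_nat_bounded[OF fin] by (auto simp: subset_iff not_less[symmetric])
  have xJ: "0 \<le> x" "x \<le> 1 / (p - 1)" using x by (auto simp: J_eq[OF p])
  define S where "S = (\<Sum>i<N. real (greedy p x i) / q ^ Suc i)"
  have tail: "(\<lambda>i. greedy p x (i + N)) = (\<lambda>_. 0)" using N by auto
  have xN: "(\<Sum>i<N. real (greedy p x i) / p ^ Suc i) = x"
    using base_value_greedy[OF p xJ] base_value_split[of p "greedy p x" N] p(1) greedy_le_1
    unfolding tail base_value_zero by simp
  \<comment> \<open>At the right endpoint the filter would be trivial and the claim false; a finite
    expansion stays below the full geometric series.\<close>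
  have "x \<noteq> 1 / (p - 1)"
  proof
    assume x: "x = 1 / (p - 1)"
    define s where "s = (\<Sum>i<N. real (greedy p x i) / p ^ Suc i)"
    have "s \<le> (\<Sum>i<N. 1 / p ^ Suc i)"
      unfolding s_def using p greedy_le_1[of p x] by (intro sum_mono divide_right_mono) auto
    also have "\<dots> = (1 - 1 / p ^ N) / (p - 1)"
    proof (induction N)
      case (Suc N)
      show ?case unfolding sum.lessThan_Suc Suc using p by (simp add: field_simps)
    qed simp
    also have "\<dots> < 1 / (p - 1)" using p by (simp add: divide_strict_right_mono)
    finally show False using xN x by (simp add: s_def)
  qed
  with xJ have x: "0 \<le> x" "x < 1 / (p - 1)" by auto
  obtain B where B: "0 < B" "eventually (\<lambda>y. \<bar>f y - f x\<bar> \<le> B * \<bar>y - x\<bar>) (at_right x)"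
    using diff unfolding at_right_J[OF x] by (rule differentiable_imp_local_bound)
  have "(\<lambda>m. x + 1 / p ^ m) \<longlonglongrightarrow> x + 0"
    by (intro tendsto_intros tendsto_const_div_power p)
  then have lim: "filterlim (\<lambda>m. x + 1 / p ^ m) (at_right x) sequentially"
    using p by (auto simp: filterlim_at intro!: always_eventually)
  have ev: "eventually (\<lambda>m. \<bar>S - f x + f 1 / q ^ m\<bar> \<le> B * (1 / p ^ m)) sequentially"
    using eventually_compose_filterlim[OF B(2) lim]
      eventually_compose_filterlim[OF eventually_quasi_greedy_at_right[OF x(1), where N = N and p = p] lim]
      eventually_ge_at_top[of N]
  proof eventually_elim
    case (elim m)
    let ?y = "x + 1 / p ^ m"
    have dig: "quasi_greedy p ?y k = greedy p x k" if "k < N" for k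
      using elim(2) that by simp
    have Sp: "(\<Sum>k<N. real (quasi_greedy p ?y k) / p ^ Suc k) = x"
      using dig by (intro trans[OF sum.cong xN]) auto
    have Sq: "(\<Sum>k<N. real (quasi_greedy p ?y k) / q ^ Suc k) = S"
      unfolding S_def using dig by (intro sum.cong) auto
    have "p ^ N * (?y - x) = 1 / p ^ (m - N)"
      using p(1) elim(3) by (simp add: power_diff)
    then have "f ?y = S + f 1 / q ^ (m - N) / q ^ N"
      using f_split[of ?y N] unfolding Sp Sq by (simp only: f_inverse_power)
    also have "\<dots> = S + f 1 / q ^ m"
      using q elim(3) by (simp add: power_diff)
    finally have "S - f x + f 1 / q ^ m = f ?y - f x" by linarith
    then show ?case using elim(1) p(1) by simp
  qed
  \<comment> \<open>\<open>S\<close> is the limit of \<open>f\<close> along these points, and the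
    bound forces this limit to be \<open>f x\<close>.\<close>
  have zero: "S - f x = 0"
  proof -
    have "(\<lambda>m. S - f x + f 1 / q ^ m) \<longlonglongrightarrow> S - f x + 0"
      by (intro tendsto_intros tendsto_const_div_power q)
    moreover have "(\<lambda>m. S - f x + f 1 / q ^ m) \<longlonglongrightarrow> 0"
    proof (rule Lim_null_comparison)
      show "eventually (\<lambda>m. norm (S - f x + f 1 / q ^ m) \<le> B / p ^ m) sequentially"
        using ev by simp
    qed (rule tendsto_const_div_power[OF p(1)])
    ultimately show ?thesis using LIMSEQ_unique by fastforce
  qed
  from ev have "eventually (\<lambda>m. f 1 \<le> B / (p / q) ^ m) sequentially"
  proof eventually_elim
    case (elim m)
    then show ?case using zero p q f_1_pos by (simp add: field_simps power_divide)
  qed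
  then have "f 1 \<le> 0"
    using assms(1) q by (intro tendsto_lowerbound[OF tendsto_const_div_power[of "p / q" B]]) auto
  with f_1_pos show False by simp
qed

text \<open>The descent is the jump of \<open>f\<close> at \<open>1 / p ^ 2\<close>, transported into the given interval by a small copy.\<close>

lemma nowhere_monotone:
  assumes "q < p"
  shows "nowhere_monotone_on (J p) f"
  unfolding nowhere_monotone_on_def
proof (intro allI impI)
  fix I assume "is_interval I \<and> I \<subseteq> J p \<and> (\<exists>u\<in>I. \<exists>v\<in>I. u < v)"
  then obtain u v where I: "is_interval I" "I \<subseteq> J p" and uv: "u \<in> I" "v \<in> I" "u < v"
    by auto
  have v: "0 < v" "v \<le> 1 / (p - 1)" using I(2) uv by (auto simp: J_eq[OF p])
  have "eventually (\<lambda>n. 1 / (p - 1) / p ^ n < v - u) sequentially"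
    using tendsto_const_div_power[OF p(1), of "1 / (p - 1)"] uv by (intro order_tendstoD(2)) auto
  then obtain N where N: "\<And>n. N \<le> n \<Longrightarrow> 1 / (p - 1) / p ^ n < v - u"
    by (auto simp: eventually_sequentially)
  obtain n R P Q where copy: "N \<le> n" "1 / p < R" "R \<le> 1 / (p - 1)" "v = P + R / p ^ n"
    "\<forall>w\<in>{0<..R}. f (P + w / p ^ n) = Q + f w / q ^ n"
    by (rule small_copies[OF v, of N])
  have mem: "P + w / p ^ n \<in> I" if "0 < w" "w \<le> 1 / p" for w
  proof -
    have "R / p ^ n \<le> 1 / (p - 1) / p ^ n" "w / p ^ n \<le> R / p ^ n" "0 \<le> w / p ^ n"
      using copy that p by (auto intro!: divide_right_mono simp del: divide_divide_eq_left)
    with copy(4) N[OF copy(1)] have "u \<le> P + w / p ^ n" "P + w / p ^ n \<le> v" by linarith+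
    then show ?thesis using mem_is_interval_1_I[OF I(1) uv(1,2)] by blast
  qed
  have less: "P + w / p ^ n \<le> P + w' / p ^ n" if "w \<le> w'" for w w'
    using that p by (intro add_left_mono divide_right_mono) auto
  \<comment> \<open>Inside the copy \<open>f\<close> is a positive affine image of itself, so
    failures of monotonicity on the interval up to \<open>1 / p\<close> carry over to
    \<open>I\<close>.\<close>
  have le: "f (P + w / p ^ n) \<le> f (P + w' / p ^ n) \<longleftrightarrow> f w \<le> f w'"
    if "0 < w" "w \<le> 1 / p" "0 < w'" "w' \<le> 1 / p" for w w'
    using copy(5)[THEN bspec, of w] copy(5)[THEN bspec, of w'] that copy(2) q by (simp add: divide_le_cancel)
  have p2: "0 < 1 / p ^ 2" "1 / p ^ 2 < 1 / p" using p by (auto simp: field_simps power2_eq_square)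
  have f2: "f (1 / p ^ 2) = f 1 / q ^ 2" "f (1 / p) = f 1 / q"
    using f_inverse_power[of 2] f_inverse_power[of 1] by auto
  have "f (1 / p ^ 2) < f (1 / p)"
    unfolding f2 using q f_1_pos by (simp add: field_simps power2_eq_square)
  have "\<not> antimono_on I f"
  proof
    assume "antimono_on I f"
    then have "f (P + 1 / p / p ^ n) \<le> f (P + 1 / p ^ 2 / p ^ n)"
      by (rule monotone_onD) (use mem[of "1 / p ^ 2"] mem[of "1 / p"] less[of "1 / p ^ 2" "1 / p"] p p2 in auto)
    then show False
      using le[of "1 / p" "1 / p ^ 2"] \<open>f (1 / p ^ 2) < f (1 / p)\<close> p p2 by simp
  qed
  moreover have "\<not> mono_on I f"
  proof
    assume mono: "mono_on I f"
    have "eventually (\<lambda>k. 1 / p ^ k < 1 / p - 1 / p ^ 2) sequentially"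
      using tendsto_const_div_power[OF p(1), of 1] p2 by (intro order_tendstoD(2)) auto
    moreover have "eventually (\<lambda>k. f 1 / q ^ k < f 1 - 1) sequentially"
      using tendsto_const_div_power[OF q, of "f 1"] f_1_greater[OF assms] by (intro order_tendstoD(2)) auto
    ultimately have "eventually (\<lambda>k. 1 / p ^ k < 1 / p - 1 / p ^ 2 \<and> f 1 / q ^ k < f 1 - 1) sequentially"
      by (rule eventually_conj)
    then obtain k where k: "1 / p ^ k < 1 / p - 1 / p ^ 2" "f 1 / q ^ k < f 1 - 1"
      by (auto simp: eventually_sequentially)
    \<comment> \<open>\<open>w\<close> lies just to the right of \<open>1 / p ^ 2\<close> and has
      the digits 0, 1 followed by those of \<open>1 / p ^ k\<close>. The two conditions on
      \<open>k\<close> keep it below \<open>1 / p\<close> and make \<open>f 1 / q ^ k\<close> too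
      small to make up for the drop \<open>f 1 - 1\<close>.\<close>
    define w where "w = 1 / p ^ 2 + 1 / p ^ (k + 2)"
    have "1 / p ^ (k + 2) \<le> 1 / p ^ k"
      using p by (intro divide_left_mono power_increasing) auto
    with k(1) have w1: "w \<le> 1 / p" unfolding w_def by linarith
    have w2: "1 / p ^ 2 < w" using p unfolding w_def by simp
    have pw: "p * w = 1 / p + 1 / p ^ (k + 1)"
      using p by (simp add: w_def field_simps power2_eq_square)
    have "f w = f (p * w) / q" using w1 by (rule f_low)
    also have "f (p * w) = (1 + f (p * (p * w) - 1)) / q"
      unfolding pw using p by (intro f_high) simp
    also have "p * (p * w) - 1 = 1 / p ^ k"
      unfolding pw using p by (simp add: field_simps)
    finally have "f w = (1 + f 1 / q ^ k) / q ^ 2"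
      by (simp add: f_inverse_power power2_eq_square)
    also have "\<dots> < f 1 / q ^ 2"
      using k(2) q by (intro divide_strict_right_mono) auto
    finally have "f w < f (1 / p ^ 2)" unfolding f2 .
    moreover have "f (1 / p ^ 2) \<le> f w"
      using monotone_onD[OF mono mem[of "1 / p ^ 2"] mem[of w] less] le[of "1 / p ^ 2" w] w1 w2 p2
      by auto
    ultimately show False by simp
  qed
  ultimately show "\<not> mono_on I f \<and> \<not> antimono_on I f" by simp
qed

end

section \<open>Increasing base-change functions\<close>

context base_pair
begin

text \<open>Deleting a common first digit multiplies the distance of two points by \<open>p\<close>,
  so in a bounded interval the first digits eventually differ. The equations in the second case are
  quantified over all target bases so that two of them can be used in one induction.\<close>

lemma separation_induct [consumes 3, case_names differ same]:
  assumes "0 < x" "x < y" "y \<le> 1 / (p - 1)"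
    and differ: "\<And>x y. 0 < x \<Longrightarrow> x \<le> 1 / p \<Longrightarrow> 1 / p < y \<Longrightarrow> y \<le> 1 / (p - 1) \<Longrightarrow> P x y"
    and same: "\<And>x y d. 0 < x \<Longrightarrow> x < y \<Longrightarrow> y \<le> 1 / (p - 1) \<Longrightarrow> d \<in> {0, 1} \<Longrightarrow>
      (\<And>q. 1 < q \<Longrightarrow> base_change p q x = (d + base_change p q (p * x - d)) / q) \<Longrightarrow>
      (\<And>q. 1 < q \<Longrightarrow> base_change p q y = (d + base_change p q (p * y - d)) / q) \<Longrightarrow>
      P (p * x - d) (p * y - d) \<Longrightarrow> P x y"
  shows "P x y"
proof -
  \<comment> \<open>\<open>n\<close> bounds the number of common digits. For \<open>n = 0\<close>
    the distance would exceed the length of the interval, so the base case is vacuous.\<close>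
  have "P x y" if "0 < x" "x < y" "y \<le> 1 / (p - 1)" "1 / (p - 1) / p ^ n < y - x" for n x y
    using that
  proof (induction n arbitrary: x y)
    case (Suc n)
    have le: "p * y - 1 \<le> 1 / (p - 1)"
    proof -
      have "p * y \<le> p * (1 / (p - 1))"
        using Suc.prems(3) p by (intro mult_left_mono) auto
      also have "\<dots> = 1 / (p - 1) + 1" using p by (simp add: field_simps)
      finally show ?thesis by simp
    qed
    have IH: "P (p * x - d) (p * y - d)"
      if "0 < p * x - d" "p * y - d \<le> 1 / (p - 1)" for d
    proof (rule Suc.IH[OF that(1) _ that(2)])
      show "p * x - d < p * y - d" using Suc.prems p by simp
      have "1 / (p - 1) / p ^ Suc n * p < (y - x) * p"
        using Suc.prems(4) p by (intro mult_strict_right_mono) auto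
      moreover have "1 / (p - 1) / p ^ Suc n * p = 1 / (p - 1) / p ^ n"
        using p by simp
      ultimately show "1 / (p - 1) / p ^ n < p * y - d - (p * x - d)"
        by (simp only: left_diff_distrib) (simp add: mult.commute)
    qed
    consider "x \<le> 1 / p" "1 / p < y" | "y \<le> 1 / p" | "1 / p < x" by linarith
    then show ?case
    proof cases
      case 1
      with Suc.prems show ?thesis by (intro differ) auto
    next
      case 2
      have "p * y \<le> 1" using 2 p by (simp add: field_simps)
      then have "P (p * x - 0) (p * y - 0)"
        using IH[of 0] Suc.prems p one_le_L by simp
      then show ?thesis
        using 2 Suc.prems by (intro same[of x y 0]) (auto intro!: base_pair.f_low base_pair.intro p)
    next
      case 3
      have "1 < p * x" using 3 p by (simp add: field_simps)
      then have "P (p * x - 1) (p * y - 1)"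
        using IH[of 1] le by simp
      then show ?thesis
        using 3 Suc.prems by (intro same[of x y 1]) (auto intro!: base_pair.f_high base_pair.intro p)
    qed
  qed simp
  moreover have "eventually (\<lambda>n. 1 / (p - 1) / p ^ n < y - x) sequentially"
    using tendsto_const_div_power[OF p(1), of "1 / (p - 1)"] assms(2) by (intro order_tendstoD(2)) auto
  ultimately show ?thesis using assms(1-3) by (auto simp: eventually_sequentially)
qed

text \<open>Iterated from the trivial bound on \<open>f\<close>, the step drives the excess \<open>e\<close> to 0, where it says that \<open>f\<close> is
  increasing.\<close>

lemma f_diff_le_step:
  assumes e: "0 \<le> e" "\<And>w. 0 < w \<Longrightarrow> w \<le> 1 \<Longrightarrow> f w \<le> 1 + e"
    and "0 < w" "w \<le> v"
  shows "f w - f v \<le> e / q"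
proof -
  \<comment> \<open>Induction on the number \<open>k\<close> of deletions, started from the trivial
    bound on \<open>f\<close>; letting \<open>k\<close> grow removes the second term of the
    maximum.\<close>
  have "f w - f v \<le> max (e / q) (1 / (q - 1) / q ^ k)" if "0 < w" "w \<le> v" for k w v
    using that
  proof (induction k arbitrary: w v)
    case 0
    then show ?case using f_le[of w] f_nonneg[of v] by simp
  next
    case (Suc k)
    have max: "max (e / q) (1 / (q - 1) / q ^ k) / q \<le> max (e / q) (1 / (q - 1) / q ^ Suc k)"
    proof -
      have "e / q / q \<le> e / q"
        using divide_left_mono[of 1 q "e / q"] e(1) q by simp
      moreover have "max (e / q) (1 / (q - 1) / q ^ k) / q = max (e / q / q) (1 / (q - 1) / q ^ Suc k)"
        using q by (simp add: max_divide_distrib_right mult_ac)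
      ultimately show ?thesis by linarith
    qed
    have IH: "(f (p * w - d) - f (p * v - d)) / q \<le> max (e / q) (1 / (q - 1) / q ^ Suc k)"
      if "0 < p * w - d" for d
      using divide_right_mono[OF Suc.IH[OF that], of "p * v - d" q] max Suc.prems p q by simp
    consider "w \<le> 1 / p" "1 / p < v" | "v \<le> 1 / p" | "1 / p < w" using Suc.prems by linarith
    then show ?case
    proof cases
      case 1
      \<comment> \<open>The first digits differ: the leading 1 of \<open>v\<close> absorbs all of
        \<open>f (p * w)\<close> but at most \<open>e\<close>.\<close>
      have "p * w \<le> 1" "0 < p * w" using 1 p Suc.prems by (simp_all add: field_simps)
      then have "f (p * w) \<le> 1 + e" by (intro e)
      then have "f (p * w) - (1 + f (p * v - 1)) \<le> e" using f_nonneg[of "p * v - 1"] by linarith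
      then have "(f (p * w) - (1 + f (p * v - 1))) / q \<le> e / q"
        using q by (intro divide_right_mono) auto
      then show ?thesis
        using f_low[OF 1(1)] f_high[OF 1(2)] by (simp add: diff_divide_distrib)
    next
      case 2
      then show ?thesis
        using IH[of 0] f_low[of w] f_low[of v] Suc.prems p by (simp add: diff_divide_distrib)
    next
      case 3
      have "1 < p * w" using 3 p by (simp add: field_simps)
      then show ?thesis
        using IH[of 1] f_high[of w] f_high[of v] 3 Suc.prems
        by (simp add: diff_divide_distrib add_divide_distrib)
    qed
  qed
  from this[OF assms(3,4)] have bd: "f w - f v \<le> max (e / q) (1 / (q - 1) / q ^ k)" for k .
  have "(\<lambda>k. max (e / q) (1 / (q - 1) / q ^ k)) \<longlonglongrightarrow> max (e / q) 0"
    by (intro tendsto_max tendsto_const tendsto_const_div_power q)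
  then have "f w - f v \<le> max (e / q) 0"
    by (rule LIMSEQ_le_const) (use bd in auto)
  then show ?thesis using e(1) q by simp
qed

text \<open>Comparing \<open>w\<close> with 1 and using \<open>f 1 < 1\<close> improves a bound
  \<open>1 + e\<close> to \<open>1 + e / q\<close>; repetition removes the excess.\<close>

lemma f_le_1:
  assumes "p < q" "0 < w" "w \<le> 1"
  shows "f w \<le> 1"
proof -
  have "f w \<le> 1 + 1 / (q - 1) / q ^ n" if "0 < w" "w \<le> 1" for n w
    using that
  proof (induction n arbitrary: w)
    case 0
    then show ?case using f_le[of w] by simp
  next
    case (Suc n)
    have "f w - f 1 \<le> 1 / (q - 1) / q ^ n / q"
      using Suc q by (intro f_diff_le_step) auto
    then show ?case using f_1_less[OF assms(1)] by (simp add: mult_ac)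
  qed
  note bd = this[OF assms(2,3)]
  have "(\<lambda>n. 1 + 1 / (q - 1) / q ^ n) \<longlonglongrightarrow> 1 + 0"
    by (intro tendsto_intros tendsto_const_div_power q)
  from LIMSEQ_le_const[OF this] bd show ?thesis by auto
qed

text \<open>Excess 0 in \<open>f_diff_le_step\<close>. The whole line is covered because later the
  points \<open>x + h\<close> and \<open>x - h\<close> may leave \<open>J p\<close>.\<close>

lemma mono_f:
  assumes "p < q"
  shows "mono f"
proof (rule monoI)
  fix w v :: real assume "w \<le> v"
  show "f w \<le> f v"
  proof (cases "w \<le> 0")
    case True
    then show ?thesis using f_nonneg by (simp add: f_nonpos)
  next
    case False
    then show ?thesis
      using f_diff_le_step[of 0 w v] f_le_1[OF assms] \<open>w \<le> v\<close> by simp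
  qed
qed

lemma f_pos:
  assumes "p < q" "0 < x"
  shows "0 < f x"
proof -
  have "eventually (\<lambda>n. 1 / p ^ n < x) sequentially"
    using tendsto_const_div_power[OF p(1), of 1] assms(2) by (intro order_tendstoD(2)) auto
  then obtain n where "1 / p ^ n \<le> x" by (auto simp: eventually_sequentially intro: less_imp_le)
  then have "f (1 / p ^ n) \<le> f x" by (rule monoD[OF mono_f[OF assms(1)]])
  moreover have "0 < f (1 / p ^ n)"
    unfolding f_inverse_power using f_1_pos q by simp
  ultimately show ?thesis by linarith
qed

text \<open>Here \<open>f (p * x)\<close> is at most \<open>f 1\<close>, while \<open>y\<close> has
  a leading 1. This uniform gap settles the \<open>differ\<close> case both for strictness and for
  the comparison of two target bases.\<close>

lemma f_jump:
  assumes "p < q" "0 < x" "x \<le> 1 / p" "1 / p < y"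
  shows "(1 - f 1) / q \<le> f y - f x"
proof -
  have "p * x \<le> 1" using assms p by (simp add: field_simps)
  then have "f (p * x) \<le> f 1" by (rule monoD[OF mono_f[OF assms(1)]])
  then have "(1 - f 1) / q \<le> (1 + f (p * y - 1) - f (p * x)) / q"
    using f_nonneg[of "p * y - 1"] q by (intro divide_right_mono) auto
  then show ?thesis
    using f_low[OF assms(3)] f_high[OF assms(4)] by (simp add: diff_divide_distrib)
qed

lemma strict_mono_f:
  assumes "p < q"
  shows "strict_mono_on (J p) f"
proof (rule strict_mono_onI)
  fix x y assume "x \<in> J p" "y \<in> J p" and xy: "x < y"
  then have J: "0 \<le> x" "y \<le> 1 / (p - 1)" by (auto simp: J_eq[OF p])
  show "f x < f y"
  proof (cases "x = 0")
    case True
    then show ?thesis using f_pos[OF assms, of y] xy by (simp add: f_nonpos)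
  next
    case False
    with J have "0 < x" by simp
    from this xy J(2) show ?thesis
    proof (induction rule: separation_induct)
      case (differ x y)
      have "0 < (1 - f 1) / q" using f_1_less[OF assms] q by simp
      with f_jump[OF assms differ(1-3)] show ?case by linarith
    next
      case (same x y d)
      then show ?case using q by (simp add: divide_strict_right_mono)
    qed
  qed
qed

end

section \<open>Differentiability almost everywhere\<close>

text \<open>Deleting a common digit multiplies the increments by \<open>q\<close> and
  \<open>r\<close>, and \<open>r powr s = q\<close> leaves the inequality invariant. When the first
  digits differ, the increment for \<open>r\<close> is bounded below by the gap
  \<open>D\<close>.\<close>

lemma base_change_diff_le_powr:
  fixes p q r :: real
  assumes "1 < p" "p \<le> 2" "p < r" "r < q"
  obtains C where "0 < C"
    "\<And>x y. 0 < x \<Longrightarrow> x < y \<Longrightarrow> y \<le> 1 / (p - 1) \<Longrightarrow>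
      base_change p q y - base_change p q x \<le>
        C * (base_change p r y - base_change p r x) powr (ln q / ln r)"
proof -
  define s where "s = ln q / ln r"
  interpret f: base_pair p q by standard (use assms in auto)
  interpret g: base_pair p r by standard (use assms in auto)
  have s: "0 < s" "r powr s = q"
    using assms by (auto simp: s_def powr_def)
  define D where "D = (1 - g.f 1) / r"
  have D: "0 < D" using g.f_1_less assms by (simp add: D_def)
  \<comment> \<open>Chosen so that \<open>C * D powr s\<close> is the trivial upper bound
    \<open>1 / (q - 1)\<close> for the increment on the left.\<close>
  define C where "C = 1 / (q - 1) / D powr s"
  have C: "0 < C" using D assms by (simp add: C_def)
  have "f.f y - f.f x \<le> C * (g.f y - g.f x) powr s"
    if "0 < x" "x < y" "y \<le> 1 / (p - 1)" for x y
    using that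
  proof (induction rule: f.separation_induct)
    case (differ x y)
    have "f.f y - f.f x \<le> C * D powr s"
      using f.f_le[of y] f.f_nonneg[of x] D by (simp add: C_def)
    also have "D \<le> g.f y - g.f x"
      unfolding D_def using g.f_jump[OF assms(3) differ(1-3)] .
    then have "C * D powr s \<le> C * (g.f y - g.f x) powr s"
      using C D s(1) by (intro mult_left_mono powr_mono2) auto
    finally show ?case .
  next
    case (same x y d)
    have g: "g.f (p * y - d) - g.f (p * x - d) = r * (g.f y - g.f x)"
      using same(5,6)[OF g.q] assms by (simp add: field_simps)
    have "g.f x \<le> g.f y" using monoD[OF g.mono_f[OF assms(3)], of x y] same by simp
    then have "(g.f (p * y - d) - g.f (p * x - d)) powr s = q * (g.f y - g.f x) powr s"
      unfolding g using assms s by (simp add: powr_mult)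
    moreover have "f.f y - f.f x = (f.f (p * y - d) - f.f (p * x - d)) / q"
      using same(5,6)[OF f.q] by (simp add: diff_divide_distrib[symmetric])
    moreover have "(f.f (p * y - d) - f.f (p * x - d)) / q \<le>
        C * (g.f (p * y - d) - g.f (p * x - d)) powr s / q"
      using same(7) f.q by (intro divide_right_mono) auto
    ultimately show ?case using f.q by simp
  qed
  with C that show thesis unfolding s_def by blast
qed

section \<open>Hoelder condition for bounded monotone functions\<close>

text \<open>By translation the integral is a difference of integrals of \<open>g\<close> over two
  shifted intervals, of which only a piece of length \<open>2 * h\<close> contributes to the upper
  bound.\<close>

lemma nn_integral_mono_increment_le:
  fixes g :: "real \<Rightarrow> real"
  assumes "mono g" and g: "\<And>x. 0 \<le> g x" "\<And>x. g x \<le> K" and "0 \<le> h" "a \<le> b"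
  shows "(\<integral>\<^sup>+x. ennreal (g (x + h) - g (x - h)) * indicator {a..b} x \<partial>lborel) \<le> ennreal (2 * h * K)"
proof -
  have [measurable]: "g \<in> borel_measurable borel"
    using \<open>mono g\<close> by (rule borel_measurable_mono)
  let ?D = "\<integral>\<^sup>+x. ennreal (g (x + h) - g (x - h)) * indicator {a..b} x \<partial>lborel"
  let ?G = "\<integral>\<^sup>+x. ennreal (g x) * indicator {a-h..b-h} x \<partial>lborel"
  have K: "0 \<le> K" using g[of 0] by linarith
  have shift: "(\<integral>\<^sup>+x. ennreal (g (x + c)) * indicator {a..b} x \<partial>lborel) =
      (\<integral>\<^sup>+x. ennreal (g x) * indicator {a+c..b+c} x \<partial>lborel)" for c
  proof -
    have "(\<integral>\<^sup>+x. ennreal (g x) * indicator {a+c..b+c} x \<partial>lborel) =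
        (\<integral>\<^sup>+x. ennreal (g (c + 1 * x)) * indicator {a+c..b+c} (c + 1 * x) \<partial>lborel)"
      by (subst nn_integral_real_affine[where c = 1 and t = c]) auto
    also have "\<dots> = (\<integral>\<^sup>+x. ennreal (g (x + c)) * indicator {a..b} x \<partial>lborel)"
      by (intro nn_integral_cong) (auto simp: indicator_def add.commute)
    finally show ?thesis ..
  qed
  \<comment> \<open>Subtraction of extended nonnegative reals is avoided by adding \<open>?G\<close>
    to both sides; its finiteness allows the cancellation at the end.\<close>
  have "?D + ?G = (\<integral>\<^sup>+x. ennreal (g (x + h) - g (x - h)) * indicator {a..b} x
      + ennreal (g (x + (- h))) * indicator {a..b} x \<partial>lborel)"
    using shift[of "-h"] by (subst nn_integral_add) auto
  also have "\<dots> = (\<integral>\<^sup>+x. ennreal (g (x + h)) * indicator {a..b} x \<partial>lborel)"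
  proof (intro nn_integral_cong)
    fix x
    have "g (x - h) \<le> g (x + h)" using \<open>0 \<le> h\<close> by (intro monoD[OF \<open>mono g\<close>]) auto
    then show "ennreal (g (x + h) - g (x - h)) * indicator {a..b} x
        + ennreal (g (x + (- h))) * indicator {a..b} x = ennreal (g (x + h)) * indicator {a..b} x"
      using g by (auto simp: indicator_def ennreal_plus[symmetric] simp del: ennreal_plus)
  qed
  also have "\<dots> = (\<integral>\<^sup>+x. ennreal (g x) * indicator {a+h..b+h} x \<partial>lborel)"
    by (rule shift)
  \<comment> \<open>The right-shifted interval is covered by the left-shifted one and an interval of
    length \<open>2 * h\<close> at the right end.\<close>
  also have "\<dots> \<le> (\<integral>\<^sup>+x. ennreal (g x) * indicator {a-h..b-h} x + ennreal K * indicator {b-h..b+h} x \<partial>lborel)"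
    using \<open>0 \<le> h\<close> g by (intro nn_integral_mono) (auto simp: indicator_def intro!: ennreal_leI)
  also have "\<dots> = ?G + ennreal K * ennreal (2 * h)"
    using \<open>0 \<le> h\<close> by (subst nn_integral_add) (auto simp: nn_integral_cmult_indicator)
  also have "\<dots> = ?G + ennreal (2 * h * K)"
    using K \<open>0 \<le> h\<close> by (simp add: ennreal_mult[symmetric] mult_ac)
  finally have le: "?G + ?D \<le> ?G + ennreal (2 * h * K)" by (simp add: add.commute)
  have "?G \<le> (\<integral>\<^sup>+x. ennreal K * indicator {a-h..b-h} x \<partial>lborel)"
    using g by (intro nn_integral_mono) (auto simp: indicator_def intro!: ennreal_leI)
  also have "\<dots> = ennreal K * ennreal (b - a)"
    using \<open>a \<le> b\<close> by (simp add: nn_integral_cmult_indicator)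
  also have "\<dots> < \<infinity>" by (simp add: ennreal_mult_less_top)
  finally show ?thesis using le by (auto simp: ennreal_add_left_cancel_le)
qed

text \<open>Weighted by \<open>1 / h powr t\<close>, the integrals of the increments over the dyadic steps \<open>h\<close> form a
  convergent geometric series, so the series of increments itself converges almost everywhere.\<close>

lemma AE_mono_increment_le_powr:
  fixes g :: "real \<Rightarrow> real"
  assumes "mono g" and g: "\<And>x. 0 \<le> g x" "\<And>x. g x \<le> K" and "t < 1" "a \<le> b"
  shows "AE x in lborel. x \<in> {a..b} \<longrightarrow>
    (\<exists>B. \<forall>n. g (x + (1/2) ^ n) - g (x - (1/2) ^ n) \<le> B * ((1/2) ^ n) powr t)"
proof -
  have [measurable]: "g \<in> borel_measurable borel"
    using \<open>mono g\<close> by (rule borel_measurable_mono)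
  define h :: "nat \<Rightarrow> real" where "h n = (1/2) ^ n" for n
  have h: "0 < h n" for n by (simp add: h_def)
  define F where "F n x = ennreal (1 / h n powr t) *
    (ennreal (g (x + h n) - g (x - h n)) * indicator {a..b} x)" for n x
  have K: "0 \<le> K" using g[of 0] by linarith
  \<comment> \<open>\<open>\<rho> ^ n\<close> equals \<open>h n / h n powr t\<close>, and
    \<open>t < 1\<close> makes the ratio less than 1.\<close>
  define \<rho> :: real where "\<rho> = (1/2) powr (1 - t)"
  have \<rho>: "0 < \<rho>" "\<rho> < 1"
    using \<open>t < 1\<close> powr_less_mono'[of "1/2" 0 "1 - t"] by (auto simp: \<rho>_def)
  have "(\<integral>\<^sup>+x. (\<Sum>n. F n x) \<partial>lborel) = (\<Sum>n. \<integral>\<^sup>+x. F n x \<partial>lborel)"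
    by (rule nn_integral_suminf) (simp add: F_def)
  also have "\<dots> \<le> (\<Sum>n. ennreal (2 * K * \<rho> ^ n))"
  proof (rule suminf_le)
    fix n
    have "(\<integral>\<^sup>+x. F n x \<partial>lborel) = ennreal (1 / h n powr t) *
        (\<integral>\<^sup>+x. ennreal (g (x + h n) - g (x - h n)) * indicator {a..b} x \<partial>lborel)"
      unfolding F_def by (rule nn_integral_cmult) simp
    also have "\<dots> \<le> ennreal (1 / h n powr t) * ennreal (2 * h n * K)"
      using h[of n] assms by (intro mult_left_mono nn_integral_mono_increment_le) auto
    also have "\<dots> = ennreal (2 * K * (h n / h n powr t))"
      using h[of n] K by (simp add: ennreal_mult[symmetric] field_simps)
    also have "h n / h n powr t = \<rho> ^ n"
    proof -
      have "h n / h n powr t = h n powr (1 - t)"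
        using h[of n] by (simp add: powr_diff)
      also have "\<dots> = \<rho> ^ n"
        by (simp add: \<rho>_def h_def powr_realpow[symmetric] powr_powr mult.commute)
      finally show ?thesis .
    qed
    finally show "(\<integral>\<^sup>+x. F n x \<partial>lborel) \<le> ennreal (2 * K * \<rho> ^ n)" .
  qed auto
  also have "\<dots> = ennreal (\<Sum>n. 2 * K * \<rho> ^ n)"
    using \<rho> K by (intro suminf_ennreal2 summable_mult summable_geometric) auto
  also have "\<dots> < \<infinity>" by simp
  finally have "(\<integral>\<^sup>+x. (\<Sum>n. F n x) \<partial>lborel) \<noteq> \<infinity>" by simp
  then have "AE x in lborel. (\<Sum>n. F n x) \<noteq> \<infinity>"
    by (rule nn_integral_PInf_AE[rotated]) (simp add: F_def)
  then show ?thesis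
  proof (rule AE_mp, intro AE_I2 impI)
    fix x assume fin: "(\<Sum>n. F n x) \<noteq> \<infinity>" and x: "x \<in> {a..b}"
    define B where "B = enn2real (\<Sum>n. F n x)"
    show "\<exists>B. \<forall>n. g (x + (1/2) ^ n) - g (x - (1/2) ^ n) \<le> B * ((1/2) ^ n) powr t"
    proof (intro exI[of _ B] allI)
      fix n
      have "F n x \<le> (\<Sum>n. F n x)"
        using sum_le_suminf[of "\<lambda>n. F n x" "{n}"] by simp
      also have "\<dots> = ennreal B" using fin by (simp add: B_def top.not_eq_extremum)
      finally have "ennreal (1 / h n powr t * (g (x + h n) - g (x - h n))) \<le> ennreal B"
        using x h[of n] by (simp add: F_def ennreal_mult'[symmetric])
      then have "1 / h n powr t * (g (x + h n) - g (x - h n)) \<le> B"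
        by (simp add: ennreal_le_iff B_def)
      then have "g (x + h n) - g (x - h n) \<le> B * h n powr t"
        using h[of n] by (simp add: field_simps)
      then show "g (x + (1/2) ^ n) - g (x - (1/2) ^ n) \<le> B * ((1/2) ^ n) powr t"
        by (simp add: h_def)
    qed
  qed
qed

text \<open>The index before the first power below \<open>d\<close> works; \<open>d < 1\<close>
  ensures that there is one. This passes from dyadic steps to arbitrary distances at the cost of a
  factor 2.\<close>

lemma dyadic_between:
  fixes d :: real
  assumes "0 < d" "d < 1"
  obtains n where "d \<le> (1/2) ^ n" "(1/2) ^ n \<le> 2 * d"
proof -
  obtain m where m: "(1/2) ^ m < d" using real_arch_pow_inv[of d "1/2"] assms by auto
  define k where "k = (LEAST m. (1/2) ^ m < d)"
  have k: "(1/2) ^ k < d" unfolding k_def using m by (rule LeastI)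
  with assms have "k \<noteq> 0" by (metis less_irrefl less_trans power_0)
  then obtain n where n: "k = Suc n" by (cases k) auto
  then have "\<not> (1/2) ^ n < d" using not_less_Least[of n "\<lambda>m. (1/2) ^ m < d"] by (simp add: k_def)
  with k n show thesis by (intro that[of n]) auto
qed

text \<open>The Hoelder bound of exponent \<open>t\<close> for target base \<open>r\<close>, raised
  to the power \<open>s\<close>, bounds the increments of \<open>f\<close> by a multiple of
  \<open>\<bar>y - x\<bar> powr (t * s)\<close>. An exponent above 1 makes the derivative 0.\<close>

lemma (in base_pair) AE_differentiable:
  assumes "p < q"
  shows "AE x in lebesgue. x \<in> J p \<longrightarrow> f differentiable (at x within J p)"
proof -
  define r where "r = (p + q) / 2"
  have r: "p < r" "r < q" "1 < r" using assms p by (auto simp: r_def)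
  interpret g: base_pair p r by standard (use p r in auto)
  define s where "s = ln q / ln r"
  have "1 < s" using r by (simp add: s_def)
  \<comment> \<open>The midpoint of \<open>1 / s\<close> and 1: below 1 as the integral estimate
    requires, and with \<open>t * s\<close> above 1.\<close>
  define t where "t = (1 + 1 / s) / 2"
  have t: "0 < t" "t < 1" "1 < t * s" using \<open>1 < s\<close> by (auto simp: t_def field_simps)
  obtain C where C: "0 < C"
    "\<And>x y. 0 < x \<Longrightarrow> x < y \<Longrightarrow> y \<le> 1 / (p - 1) \<Longrightarrow> f y - f x \<le> C * (g.f y - g.f x) powr s"
    unfolding s_def using base_change_diff_le_powr[OF p r(1,2)] by metis
  have "AE x in lborel. x \<in> {0..1 / (p - 1)} \<longrightarrow>
      (\<exists>B. \<forall>n. g.f (x + (1/2) ^ n) - g.f (x - (1/2) ^ n) \<le> B * ((1/2) ^ n) powr t)"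
    using g.mono_f[OF r(1)] g.f_nonneg g.f_le t(2) p by (intro AE_mono_increment_le_powr) auto
  then have "AE x in lborel. x \<in> J p \<longrightarrow> f differentiable (at x within J p)"
    using AE_lborel_singleton[of 0]
  proof eventually_elim
    case (elim x)
    show ?case
    proof
      assume "x \<in> J p"
      with elim(2) have x: "0 < x" "x \<le> 1 / (p - 1)" by (auto simp: J_eq[OF p])
      with elim(1) obtain B where
        B: "\<And>n. g.f (x + (1/2) ^ n) - g.f (x - (1/2) ^ n) \<le> B * ((1/2) ^ n) powr t"
        by auto
      have "0 \<le> B"
        using order_trans[OF _ B[of 0]] monoD[OF g.mono_f[OF r(1)], of "x - 1" "x + 1"] by simp
      define C' where "C' = C * (B * 2 powr t) powr s"
      have bound: "\<bar>f y - f x\<bar> \<le> C' * \<bar>y - x\<bar> powr (t * s)"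
        if y: "0 < y" "y \<le> 1 / (p - 1)" "y \<noteq> x" "\<bar>y - x\<bar> < 1" for y
      proof -
        obtain n where n: "\<bar>y - x\<bar> \<le> (1/2) ^ n" "(1/2) ^ n \<le> 2 * \<bar>y - x\<bar>"
          using dyadic_between[of "\<bar>y - x\<bar>"] y by auto
        \<comment> \<open>Both points lie in the window of radius \<open>(1/2) ^ n\<close> around
          \<open>x\<close>, so the symmetric increment controls the one between them on either side
          of \<open>x\<close>.\<close>
        have "g.f (x - (1/2) ^ n) \<le> g.f (min x y)" "g.f (max x y) \<le> g.f (x + (1/2) ^ n)"
          using n(1) by (auto intro!: monoD[OF g.mono_f[OF r(1)]])
        then have "g.f (max x y) - g.f (min x y) \<le> B * ((1/2) ^ n) powr t"
          using B[of n] by linarith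
        also have "\<dots> \<le> B * (2 * \<bar>y - x\<bar>) powr t"
          using n(2) \<open>0 \<le> B\<close> t(1) by (intro mult_left_mono powr_mono2) auto
        also have "\<dots> = B * 2 powr t * \<bar>y - x\<bar> powr t"
          by (simp add: powr_mult)
        finally have le: "g.f (max x y) - g.f (min x y) \<le> B * 2 powr t * \<bar>y - x\<bar> powr t" .
        have "\<bar>f y - f x\<bar> = f (max x y) - f (min x y)"
          using monoD[OF mono_f[OF assms], of x y] monoD[OF mono_f[OF assms], of y x]
          by (auto simp: max_def min_def)
        also have "\<dots> \<le> C * (g.f (max x y) - g.f (min x y)) powr s"
          using x y by (intro C) (auto simp: max_def min_def)
        also have "\<dots> \<le> C * (B * 2 powr t * \<bar>y - x\<bar> powr t) powr s"
          using le C(1) \<open>1 < s\<close> monoD[OF g.mono_f[OF r(1)], of "min x y" "max x y"]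
          by (intro mult_left_mono powr_mono2) auto
        also have "\<dots> = C' * \<bar>y - x\<bar> powr (t * s)"
          using \<open>0 \<le> B\<close> by (simp add: C'_def powr_mult powr_powr)
        finally show ?thesis .
      qed
      have "((\<lambda>y. (f y - f x) / (y - x)) \<longlongrightarrow> 0) (at x within J p)"
      proof (rule Lim_null_comparison)
        have 1: "eventually (\<lambda>y. 0 < y \<and> \<bar>y - x\<bar> < 1) (at x within J p)"
        proof (rule eventually_conj)
          show "eventually (\<lambda>y. 0 < y) (at x within J p)"
            using x(1) by (intro order_tendstoD(1)[OF tendsto_ident_at])
          have "((\<lambda>y. \<bar>y - x\<bar>) \<longlongrightarrow> \<bar>x - x\<bar>) (at x within J p)"
            by (intro tendsto_intros)
          then show "eventually (\<lambda>y. \<bar>y - x\<bar> < 1) (at x within J p)"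
            by (rule order_tendstoD(2)) simp
        qed
        have 2: "eventually (\<lambda>y. y \<in> J p \<and> y \<noteq> x) (at x within J p)"
          by (simp add: eventually_at_filter)
        from 1 2 show "eventually (\<lambda>y. norm ((f y - f x) / (y - x)) \<le> C' * \<bar>y - x\<bar> powr (t * s - 1)) (at x within J p)"
        proof eventually_elim
          case (elim y)
          then have "\<bar>f y - f x\<bar> \<le> C' * \<bar>y - x\<bar> powr (t * s)"
            by (intro bound) (auto simp: J_eq[OF p])
          then have "\<bar>f y - f x\<bar> / \<bar>y - x\<bar> \<le> C' * \<bar>y - x\<bar> powr (t * s) / \<bar>y - x\<bar>"
            by (intro divide_right_mono) auto
          with elim show ?case by (simp add: powr_diff abs_divide)
        qed
        have "((\<lambda>y. C' * \<bar>y - x\<bar> powr (t * s - 1)) \<longlongrightarrow> C' * \<bar>x - x\<bar> powr (t * s - 1)) (at x within J p)"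
          using t(3) by (intro tendsto_mult tendsto_const tendsto_powr' tendsto_intros) auto
        then show "((\<lambda>y. C' * \<bar>y - x\<bar> powr (t * s - 1)) \<longlongrightarrow> 0) (at x within J p)"
          by simp
      qed
      then have "(f has_real_derivative 0) (at x within J p)"
        by (simp add: has_field_derivative_iff)
      then show "f differentiable (at x within J p)"
        unfolding real_differentiable_def by blast
    qed
  qed
  then show ?thesis by (rule AE_completion)
qed

theorem theorem1p3:
  fixes p q :: real
  assumes "1 < p" and "p \<le> 2" and "1 < q" and "p \<noteq> q"
  shows
    "(\<forall>x\<in>J p. continuous (at x within J p \<inter> {..<x}) (base_change p q)) \<and>
     (\<forall>x\<in>{0..<1 / (p - 1)}.
        continuous (at x within J p \<inter> {x<..}) (base_change p q) \<longleftrightarrow> quasi_greedy p x = greedy p x) \<and>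
     (q < p \<longrightarrow>
        nowhere_monotone_on (J p) (base_change p q) \<and>
        (\<forall>x\<in>{0<..1 / (p - 1)}.
           \<not> base_change p q differentiable (at x within J p \<inter> {..<x})) \<and>
        (\<forall>x\<in>J p. finite {i. greedy p x i \<noteq> 0} \<longrightarrow>
           \<not> base_change p q differentiable (at x within J p \<inter> {x<..}))) \<and>
     (p < q \<longrightarrow>
        strict_mono_on (J p) (base_change p q) \<and>
        (AE x in lebesgue. x \<in> J p \<longrightarrow> base_change p q differentiable (at x within J p)))"
proof -
  interpret base_pair p q by standard (use assms in auto)
  show ?thesis
    using continuous_left continuous_right_iff[OF assms(4)] nowhere_monotone not_left_differentiable
      not_right_differentiable strict_mono_f AE_differentiable
    by (auto simp del: One_nat_def)
qed

end
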